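(* Let $L$ be a frame. Then $L$ is a zero-dimensional frame if and only if $L$ is a $c$-completely regular frame.
   Context: Let $L$ be a frame with top $\top$ and bottom $\bot$. The frame of reals $\mathcal L(\mathbb R)$ is generated by pairs $(p,q)$, $p,q\in\mathbb Q$, subject to: (R1) $(p,q)\wedge(r,s)=(p\vee r,q\wedge s)$; (R2) $(p,q)\vee(r,s)=(p,s)$ whenever $p\le r<q\le s$; (R3) $(p,q)=\bigvee\{(r,s)\mid p<r<s<q\}$; (R4) $\top=\bigvee\{(p,q)\mid p,q\in\mathbb Q\}$. $\mathcal R(L)$ is the set of frame homomorphisms $\mathcal L(\mathbb R)\to L$; it is an $f$-ring with operations, for $\diamond\in\{+,\cdot,\wedge,\vee\}$, $(\alpha\diamond\beta)(p,q)=\bigvee\{\alpha(r,s)\wedge\beta(u,v)\mid \langle r,s\rangle\diamond\langle u,v\rangle\subseteq\langle p,q\rangle\}$, where $\langle p,q\rangle=\{t\in\mathbb R\mid p<t<q\}$. For $r\in\mathbb R$, the constant $\mathbf r\in\mathcal R(L)$ satisfies $\mathbf r(p,q)=\top$ if $p<r<q$ and $\bot$ otherwise; $\alpha-r$ means $\alpha-\mathbf r$. Put $(p,-)=\bigvee_{r,s>p}(r,s)$ and $(-,q)=\bigvee_{r,s<q}(r,s)$ (with $r,s\in\mathbb Q$). The cozero element of $\alpha$ is $\mathrm{coz}(\alpha)=\alpha(-,0)\vee\alpha(0,-)$. Put $R_\alpha=\{r\in\mathbb R\mid \mathrm{coz}(\alpha-r)\ne\top\}$, $\mathcal C_c(L)=\{\alpha\in\mathcal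 R(L)\mid R_\alpha\text{ is countable}\}$ (countable includes finite), and $\mathrm{Coz}_c[L]=\{\mathrm{coz}(\alpha)\mid\alpha\in\mathcal C_c(L)\}$. $L$ is $c$-completely regular if $\mathrm{Coz}_c[L]$ is a base for $L$, i.e. every element of $L$ is a join of elements of $\mathrm{Coz}_c[L]$. $L$ is zero-dimensional if every element of $L$ is a join of complemented elements of $L$. *)

theory Defs
  imports "HOL-Analysis.Analysis" "HOL-Library.FSet"
begin

unbundle lattice_syntax

section \<open>Frames\<close>

text \<open>The library class \<^class>\<open>complete_distrib_lattice\<close> asks for complete distributivity, which is
  much stronger than the frame law.\<close>

class frame = complete_lattice +
  assumes inf_Sup_frame: "x \<sqinter> \<Squnion> A = \<Squnion> ((\<sqinter>) x ` A)"

definition frame_hom :: "('a::frame \<Rightarrow> 'b::frame) \<Rightarrow> bool" where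
  "frame_hom h \<longleftrightarrow> h \<top> = \<top> \<and> (\<forall>x y. h (x \<sqinter> y) = h x \<sqinter> h y) \<and> (\<forall>A. h (\<Squnion> A) = \<Squnion> (h ` A))"

definition complemented :: "'a::frame \<Rightarrow> bool" where
  "complemented a \<longleftrightarrow> (\<exists>b. a \<sqinter> b = \<bottom> \<and> a \<squnion> b = \<top>)"

definition is_base :: "'a::frame set \<Rightarrow> bool" where
  "is_base B \<longleftrightarrow> (\<forall>a. \<exists>S\<subseteq>B. a = \<Squnion> S)"

definition zero_dimensional :: "'a::frame itself \<Rightarrow> bool" where
  "zero_dimensional _ \<longleftrightarrow> is_base {a::'a. complemented a}"


section \<open>The frame of reals\<close>

text \<open>The frame presented by the generators \<open>(p, q)\<close> and the relations (R1)--(R4), by the usual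
  construction of a frame from a presentation. A finite set \<open>F\<close> of generators stands for its formal
  meet and a set of such \<open>F\<close> for the formal join of these meets. The elements are the sets \<open>U\<close>
  that are closed under passing to smaller formal meets and under both directions of every relation
  \<open>g = \<Squnion>S\<close>, met with an arbitrary \<open>F\<close>. The universal property is proved below
  (\<open>ivl_R1\<close> to \<open>ivl_R4\<close>, \<open>presentation\<close>).\<close>

definition saturated :: "(rat \<times> rat) fset set \<Rightarrow> bool" where
  "saturated U \<longleftrightarrow>
     (\<forall>F G. F \<in> U \<longrightarrow> F |\<union>| G \<in> U) \<and>
     (\<forall>F p q r s. finsert (p, q) (finsert (r, s) F) \<in> U \<longleftrightarrow> finsert (max p r, min q s) F \<in> U) \<and>
     (\<forall>F p q r s. p \<le> r \<and> r < q \<and> q \<le> s \<longrightarrow>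
        (finsert (p, q) F \<in> U \<and> finsert (r, s) F \<in> U \<longleftrightarrow> finsert (p, s) F \<in> U)) \<and>
     (\<forall>F p q. finsert (p, q) F \<in> U \<longleftrightarrow> (\<forall>r s. p < r \<and> r < s \<and> s < q \<longrightarrow> finsert (r, s) F \<in> U)) \<and>
     (\<forall>F. F \<in> U \<longleftrightarrow> (\<forall>p q. finsert (p, q) F \<in> U))"

lemma saturated_UNIV: "saturated UNIV"
  by (simp add: saturated_def)

lemma saturated_up: "saturated U \<Longrightarrow> F \<in> U \<Longrightarrow> F |\<union>| G \<in> U"
  unfolding saturated_def by blast

lemma saturated_Inter:
  assumes "\<And>U. U \<in> A \<Longrightarrow> saturated U" shows "saturated (\<Inter>A)"
  unfolding saturated_def
proof (intro conjI allI impI)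
  fix F G assume "F \<in> \<Inter>A" then show "F |\<union>| G \<in> \<Inter>A"
    using assms saturated_up by blast
next
  fix F and p q r s :: rat
  have "finsert (p, q) (finsert (r, s) F) \<in> U \<longleftrightarrow> finsert (max p r, min q s) F \<in> U" if "U \<in> A" for U
    using assms[OF that] unfolding saturated_def by blast
  then show "finsert (p, q) (finsert (r, s) F) \<in> \<Inter>A \<longleftrightarrow> finsert (max p r, min q s) F \<in> \<Inter>A"
    by blast
next
  fix F and p q r s :: rat assume c: "p \<le> r \<and> r < q \<and> q \<le> s"
  have "finsert (p, q) F \<in> U \<and> finsert (r, s) F \<in> U \<longleftrightarrow> finsert (p, s) F \<in> U" if "U \<in> A" for U
    using assms[OF that] c unfolding saturated_def by blast
  then show "finsert (p, q) F \<in> \<Inter>A \<and> finsert (r, s) F \<in> \<Inter>A \<longleftrightarrow> finsert (p, s) F \<in> \<Inter>A"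
    by blast
next
  fix F and p q :: rat
  have "finsert (p, q) F \<in> U \<longleftrightarrow> (\<forall>r s. p < r \<and> r < s \<and> s < q \<longrightarrow> finsert (r, s) F \<in> U)"
    if "U \<in> A" for U
    using assms[OF that] unfolding saturated_def by blast
  then show "finsert (p, q) F \<in> \<Inter>A \<longleftrightarrow>
      (\<forall>r s. p < r \<and> r < s \<and> s < q \<longrightarrow> finsert (r, s) F \<in> \<Inter>A)"
    by blast
next
  fix F
  have "F \<in> U \<longleftrightarrow> (\<forall>p q. finsert (p, q) F \<in> U)" if "U \<in> A" for U
    using assms[OF that] unfolding saturated_def by blast
  then show "F \<in> \<Inter>A \<longleftrightarrow> (\<forall>p q. finsert (p, q) F \<in> \<Inter>A)"
    by blast
qed

lemma saturated_hull: "saturated (saturated hull S)"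
  by (rule hull_in) (simp add: saturated_Inter)

lemma saturated_shift:
  assumes "saturated U" shows "saturated {H. G |\<union>| H \<in> U}"
  using assms unfolding saturated_def mem_Collect_eq funion_finsert_right funion_assoc[symmetric]
  by (intro conjI; blast)

lemma saturated_imp:
  assumes "saturated V" shows "saturated {H. \<forall>G\<in>U. G |\<union>| H \<in> V}"
proof -
  have "{H. \<forall>G\<in>U. G |\<union>| H \<in> V} = \<Inter> ((\<lambda>G. {H. G |\<union>| H \<in> V}) ` U)" by auto
  then show ?thesis using saturated_Inter[of "(\<lambda>G. {H. G |\<union>| H \<in> V}) ` U"] saturated_shift[OF assms]
    by auto
qed

typedef reals_frame = "{U. saturated U}"
  using saturated_UNIV by blast

setup_lifting type_definition_reals_frame

instantiation reals_frame :: frame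
begin

lift_definition less_eq_reals_frame :: "reals_frame \<Rightarrow> reals_frame \<Rightarrow> bool" is "(\<subseteq>)" .
lift_definition less_reals_frame :: "reals_frame \<Rightarrow> reals_frame \<Rightarrow> bool" is "(\<subset>)" .
lift_definition top_reals_frame :: reals_frame is UNIV by (rule saturated_UNIV)
lift_definition bot_reals_frame :: reals_frame is "saturated hull {}" by (rule saturated_hull)
lift_definition inf_reals_frame :: "reals_frame \<Rightarrow> reals_frame \<Rightarrow> reals_frame" is "(\<inter>)"
  subgoal for U V using saturated_Inter[of "{U, V}"] by auto done
lift_definition sup_reals_frame :: "reals_frame \<Rightarrow> reals_frame \<Rightarrow> reals_frame"
  is "\<lambda>U V. saturated hull (U \<union> V)" by (rule saturated_hull)
lift_definition Inf_reals_frame :: "reals_frame set \<Rightarrow> reals_frame" is "\<lambda>A. \<Inter>A"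
  by (rule saturated_Inter) auto
lift_definition Sup_reals_frame :: "reals_frame set \<Rightarrow> reals_frame" is "\<lambda>A. saturated hull (\<Union>A)"
  by (rule saturated_hull)

instance
proof
  fix x :: reals_frame and A :: "reals_frame set"
  show "x \<sqinter> \<Squnion> A = \<Squnion> ((\<sqinter>) x ` A)"
  proof transfer
    fix U :: "(rat \<times> rat) fset set" and A
    assume "saturated U" and A: "Ball A saturated"
    then have U: "saturated U" by simp
    let ?V = "saturated hull (\<Union> ((\<inter>) U ` A))"
    have V: "saturated ?V" by (rule saturated_hull)
    have "\<Union>A \<subseteq> {H. \<forall>G\<in>U. G |\<union>| H \<in> ?V}"
    proof clarify
      fix H G X assume "H \<in> X" "X \<in> A" "G \<in> U"
      then have "G |\<union>| H \<in> U" "G |\<union>| H \<in> X"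
        using saturated_up[OF U, of G H] saturated_up[of X H G] A by (auto simp: funion_commute)
      with \<open>X \<in> A\<close> have "G |\<union>| H \<in> \<Union> ((\<inter>) U ` A)" by blast
      then show "G |\<union>| H \<in> ?V" by (rule hull_inc)
    qed
    then have "saturated hull (\<Union>A) \<subseteq> {H. \<forall>G\<in>U. G |\<union>| H \<in> ?V}"
      by (rule hull_minimal) (rule saturated_imp[OF V])
    moreover have "H |\<union>| H = H" for H :: "(rat \<times> rat) fset" by simp
    ultimately have "U \<inter> (saturated hull (\<Union>A)) \<subseteq> ?V" by fastforce
    moreover have "?V \<subseteq> saturated hull (\<Union>A)" by (rule hull_mono) blast
    moreover have "?V \<subseteq> U" by (rule hull_minimal) (use U in auto)
    ultimately show "U \<inter> (saturated hull (\<Union>A)) = ?V" by blast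
  qed
next
  fix x z :: reals_frame and A :: "reals_frame set"
  show "x \<in> A \<Longrightarrow> \<Sqinter>A \<le> x" by transfer blast
  show "(\<And>x. x \<in> A \<Longrightarrow> z \<le> x) \<Longrightarrow> z \<le> \<Sqinter>A" by transfer blast
  show "x \<in> A \<Longrightarrow> x \<le> \<Squnion>A" by transfer (meson Sup_upper hull_subset subset_trans)
  show "(\<And>x. x \<in> A \<Longrightarrow> x \<le> z) \<Longrightarrow> \<Squnion>A \<le> z" by transfer (simp add: Sup_least hull_minimal)
  show "\<Sqinter>{} = (\<top>::reals_frame)" by transfer simp
  show "\<Squnion>{} = (\<bottom>::reals_frame)" by transfer simp
next
  fix x y z :: reals_frame
  show "(x < y) = (x \<le> y \<and> \<not> y \<le> x)" by transfer blast
  show "x \<le> x" by transfer blast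
  show "x \<le> y \<Longrightarrow> y \<le> z \<Longrightarrow> x \<le> z" by transfer blast
  show "x \<le> y \<Longrightarrow> y \<le> x \<Longrightarrow> x = y" by transfer blast
  show "x \<sqinter> y \<le> x" by transfer blast
  show "x \<sqinter> y \<le> y" by transfer blast
  show "x \<le> y \<Longrightarrow> x \<le> z \<Longrightarrow> x \<le> y \<sqinter> z" by transfer blast
  show "x \<le> x \<squnion> y" by transfer (meson Un_upper1 hull_subset subset_trans)
  show "y \<le> x \<squnion> y" by transfer (meson Un_upper2 hull_subset subset_trans)
  show "y \<le> x \<Longrightarrow> z \<le> x \<Longrightarrow> y \<squnion> z \<le> x" by transfer (simp add: hull_minimal)
qed

end

text \<open>The generator \<open>(p, q)\<close>.\<close>

lift_definition ivl :: "rat \<Rightarrow> rat \<Rightarrow> reals_frame" is "\<lambda>p q. saturated hull {{|(p, q)|}}"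
  by (rule saturated_hull)

text \<open>\<open>(p, -)\<close> and \<open>(-, q)\<close>.\<close>

definition ivl_above :: "rat \<Rightarrow> reals_frame" where
  "ivl_above p = \<Squnion> {ivl r s | r s. p < r \<and> p < s}"

definition ivl_below :: "rat \<Rightarrow> reals_frame" where
  "ivl_below q = \<Squnion> {ivl r s | r s. r < q \<and> s < q}"


section \<open>Real-valued continuous functions on a frame\<close>

definition RL :: "(reals_frame \<Rightarrow> 'a::frame) set" where
  "RL = {\<alpha>. frame_hom \<alpha>}"

text \<open>The frame homomorphism with prescribed values on the generators.\<close>

definition RL_of :: "(rat \<Rightarrow> rat \<Rightarrow> 'a::frame) \<Rightarrow> (reals_frame \<Rightarrow> 'a)" where
  "RL_of f = (THE \<alpha>. \<alpha> \<in> RL \<and> (\<forall>p q. \<alpha> (ivl p q) = f p q))"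

definition ropen :: "rat \<Rightarrow> rat \<Rightarrow> real set" where
  "ropen p q = {of_rat p <..< of_rat q}"

definition RL_op ::
    "(real \<Rightarrow> real \<Rightarrow> real) \<Rightarrow> (reals_frame \<Rightarrow> 'a) \<Rightarrow> (reals_frame \<Rightarrow> 'a) \<Rightarrow> (reals_frame \<Rightarrow> 'a::frame)" where
  "RL_op d \<alpha> \<beta> = RL_of (\<lambda>p q.
     \<Squnion> {\<alpha> (ivl r s) \<sqinter> \<beta> (ivl u v) | r s u v. {d x y | x y. x \<in> ropen r s \<and> y \<in> ropen u v} \<subseteq> ropen p q})"

definition RL_const :: "real \<Rightarrow> (reals_frame \<Rightarrow> 'a::frame)" where
  "RL_const r = RL_of (\<lambda>p q. if of_rat p < r \<and> r < of_rat q then \<top> else \<bottom>)"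

text \<open>The additive inverse in the ring of real-valued functions, see \<open>RL_add_uminus\<close>.\<close>

definition RL_uminus :: "(reals_frame \<Rightarrow> 'a) \<Rightarrow> (reals_frame \<Rightarrow> 'a::frame)" where
  "RL_uminus \<alpha> = RL_of (\<lambda>p q. \<alpha> (ivl (- q) (- p)))"

definition RL_minus :: "(reals_frame \<Rightarrow> 'a) \<Rightarrow> (reals_frame \<Rightarrow> 'a) \<Rightarrow> (reals_frame \<Rightarrow> 'a::frame)" where
  "RL_minus \<alpha> \<beta> = RL_op (+) \<alpha> (RL_uminus \<beta>)"

definition coz :: "(reals_frame \<Rightarrow> 'a::frame) \<Rightarrow> 'a" where
  "coz \<alpha> = \<alpha> (ivl_below 0) \<squnion> \<alpha> (ivl_above 0)"

definition R_set :: "(reals_frame \<Rightarrow> 'a::frame) \<Rightarrow> real set" where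
  "R_set \<alpha> = {r. coz (RL_minus \<alpha> (RL_const r)) \<noteq> \<top>}"

definition C_c :: "(reals_frame \<Rightarrow> 'a::frame) set" where
  "C_c = {\<alpha> \<in> RL. countable (R_set \<alpha>)}"

definition Coz_c :: "'a::frame set" where
  "Coz_c = coz ` C_c"

definition c_completely_regular :: "'a::frame itself \<Rightarrow> bool" where
  "c_completely_regular _ \<longleftrightarrow> is_base (Coz_c :: 'a set)"


section \<open>The universal property of the frame of reals\<close>

lemma ivl_le_iff: "ivl p q \<le> x \<longleftrightarrow> {|(p, q)|} \<in> Rep_reals_frame x"
proof (transfer, safe)
  fix p q x assume "saturated hull {{|(p, q)|}} \<subseteq> x"
  then show "{|(p, q)|} \<in> x" using hull_subset[of "{{|(p, q)|}}" saturated] by blast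
next
  fix p q x H assume "saturated x" "{|(p, q)|} \<in> x" "H \<in> saturated hull {{|(p, q)|}}"
  then show "H \<in> x" using hull_minimal[of "{{|(p, q)|}}" x saturated] by blast
qed

lemma saturated_Rep: "saturated (Rep_reals_frame x)"
  using Rep_reals_frame by blast

lemma Inf_ivl_le_aux:
  assumes "saturated U" "G |\<union>| F \<in> U" "H \<in> Rep_reals_frame (\<Sqinter>(p, q)\<in>fset F. ivl p q)"
  shows "G |\<union>| H \<in> U"
  using assms(2,3)
proof (induction F arbitrary: G)
  case empty
  then show ?case using saturated_up[OF assms(1), of G H] by simp
next
  case (insert x F)
  obtain p q where x: "x = (p, q)" by (cases x)
  have H: "H \<in> Rep_reals_frame (ivl p q)" "H \<in> Rep_reals_frame (\<Sqinter>(p, q)\<in>fset F. ivl p q)"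
    using insert.prems(2) by (simp_all add: x inf_reals_frame.rep_eq)
  have "finsert x G |\<union>| F \<in> U" using insert.prems(1) by simp
  then have "finsert x G |\<union>| H \<in> U" using H(2) by (rule insert.IH)
  then have "{{|x|}} \<subseteq> {K. (G |\<union>| H) |\<union>| K \<in> U}" by simp
  then have "saturated hull {{|x|}} \<subseteq> {K. (G |\<union>| H) |\<union>| K \<in> U}"
    by (rule hull_minimal) (rule saturated_shift[OF assms(1)])
  then have "(G |\<union>| H) |\<union>| H \<in> U" using H(1) by (auto simp: x ivl.rep_eq)
  then show ?case by (simp add: funion_assoc)
qed

lemma Inf_ivl_le:
  assumes "F \<in> Rep_reals_frame x"
  shows "(\<Sqinter>(p, q)\<in>fset F. ivl p q) \<le> x"
  unfolding less_eq_reals_frame.rep_eq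
  using Inf_ivl_le_aux[OF saturated_Rep, of "{||}" F x] assms by auto

lemma in_Rep_Inf_ivl: "F \<in> Rep_reals_frame (\<Sqinter>(p, q)\<in>fset F. ivl p q)"
proof -
  have "F \<in> Rep_reals_frame (ivl p q)" if "(p, q) \<in> fset F" for p q
  proof -
    have "{|(p, q)|} \<in> Rep_reals_frame (ivl p q)" using ivl_le_iff by blast
    then have "{|(p, q)|} |\<union>| F \<in> Rep_reals_frame (ivl p q)" by (rule saturated_up[OF saturated_Rep])
    then show ?thesis using that by (simp add: finsert_absorb)
  qed
  then show ?thesis by (auto simp: Inf_reals_frame.rep_eq)
qed

lemma reals_frame_eq_Sup: "x = (\<Squnion>F\<in>Rep_reals_frame x. \<Sqinter>(p, q)\<in>fset F. ivl p q)"
proof (rule antisym)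
  let ?y = "\<Squnion>F\<in>Rep_reals_frame x. \<Sqinter>(p, q)\<in>fset F. ivl p q"
  have "F \<in> Rep_reals_frame ?y" if "F \<in> Rep_reals_frame x" for F
    using in_Rep_Inf_ivl[of F] SUP_upper[OF that, of "\<lambda>F. \<Sqinter>(p, q)\<in>fset F. ivl p q"]
    by (auto simp: less_eq_reals_frame.rep_eq)
  then show "x \<le> ?y" by (auto simp: less_eq_reals_frame.rep_eq)
qed (auto intro: SUP_least Inf_ivl_le)

lemma Inf_finsert_ivl_le:
  "(\<Sqinter>(p, q)\<in>fset F. ivl p q) \<le> x \<longleftrightarrow> F \<in> Rep_reals_frame x"
  using Inf_ivl_le in_Rep_Inf_ivl by (auto simp: less_eq_reals_frame.rep_eq)

lemma ivl_inf_le: "ivl p q \<sqinter> ivl r s \<le> x \<longleftrightarrow> {|(p, q), (r, s)|} \<in> Rep_reals_frame x"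
  using Inf_finsert_ivl_le[of "{|(p, q), (r, s)|}" x] by simp

lemma saturatedD:
  assumes "saturated U"
  shows "finsert (p, q) (finsert (r, s) F) \<in> U \<longleftrightarrow> finsert (max p r, min q s) F \<in> U"
    and "p \<le> r \<Longrightarrow> r < q \<Longrightarrow> q \<le> s \<Longrightarrow>
      finsert (p, s) F \<in> U \<longleftrightarrow> finsert (p, q) F \<in> U \<and> finsert (r, s) F \<in> U"
    and "finsert (p, q) F \<in> U \<longleftrightarrow> (\<forall>r s. p < r \<and> r < s \<and> s < q \<longrightarrow> finsert (r, s) F \<in> U)"
    and "F \<in> U \<longleftrightarrow> (\<forall>p q. finsert (p, q) F \<in> U)"
  using assms unfolding saturated_def by blast+

lemma ivl_R1: "ivl p q \<sqinter> ivl r s = ivl (max p r) (min q s)"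
  by (rule order.antisym)
    (use ivl_inf_le ivl_le_iff saturatedD(1)[OF saturated_Rep] in blast)+

lemma ivl_R2:
  assumes "p \<le> r" "r < q" "q \<le> s" shows "ivl p q \<squnion> ivl r s = ivl p s"
proof -
  have *: "ivl p s \<le> x \<longleftrightarrow> ivl p q \<le> x \<and> ivl r s \<le> x" for x
    unfolding ivl_le_iff by (rule saturatedD(2)[OF saturated_Rep assms])
  show ?thesis
  proof (rule order.antisym)
    show "ivl p q \<squnion> ivl r s \<le> ivl p s" using *[of "ivl p s"] by simp
    show "ivl p s \<le> ivl p q \<squnion> ivl r s" using *[of "ivl p q \<squnion> ivl r s"] by simp
  qed
qed

lemma ivl_R3: "ivl p q = \<Squnion> {ivl r s | r s. p < r \<and> r < s \<and> s < q}"
proof -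
  let ?S = "{ivl r s | r s. p < r \<and> r < s \<and> s < q}"
  have *: "ivl p q \<le> x \<longleftrightarrow> (\<forall>r s. p < r \<and> r < s \<and> s < q \<longrightarrow> ivl r s \<le> x)" for x
    unfolding ivl_le_iff by (rule saturatedD(3)[OF saturated_Rep])
  show ?thesis
  proof (rule order.antisym)
    show "ivl p q \<le> \<Squnion> ?S" unfolding * by (blast intro: Sup_upper)
    show "\<Squnion> ?S \<le> ivl p q" using *[of "ivl p q"] by (auto intro: Sup_least)
  qed
qed

lemma ivl_R4: "\<top> = \<Squnion> {ivl p q | p q. True}"
proof -
  have "{||} \<in> Rep_reals_frame x \<longleftrightarrow> (\<forall>p q. ivl p q \<le> x)" for x
    unfolding ivl_le_iff by (rule saturatedD(4)[OF saturated_Rep])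
  moreover have "\<forall>p q. ivl p q \<le> \<Squnion> {ivl p q | p q. True}" by (blast intro: Sup_upper)
  ultimately have "{||} \<in> Rep_reals_frame (\<Squnion> {ivl p q | p q. True})" by blast
  then have "(\<Sqinter>(p, q)\<in>fset {||}. ivl p q) \<le> \<Squnion> {ivl p q | p q. True}" by (rule Inf_ivl_le)
  then have "\<top> \<le> \<Squnion> {ivl p q | p q. True}" by simp
  then show ?thesis by (rule top_le[symmetric])
qed

lemma frame_homD:
  assumes "frame_hom h"
  shows "h \<top> = \<top>" "h (x \<sqinter> y) = h x \<sqinter> h y" "h (\<Squnion> A) = \<Squnion> (h ` A)"
    "h (x \<squnion> y) = h x \<squnion> h y" "h \<bottom> = \<bottom>"
proof -
  show *: "h \<top> = \<top>" "h (x \<sqinter> y) = h x \<sqinter> h y" "h (\<Squnion> A) = \<Squnion> (h ` A)" for x y A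
    using assms by (auto simp: frame_hom_def)
  show "h (x \<squnion> y) = h x \<squnion> h y" using *(3)[of "{x, y}"] by simp
  show "h \<bottom> = \<bottom>" using *(3)[of "{}"] by simp
qed

lemma frame_hom_Inf_fset:
  assumes "frame_hom h"
  shows "h (\<Sqinter>(p, q)\<in>fset F. ivl p q) = (\<Sqinter>(p, q)\<in>fset F. h (ivl p q))"
  by (induction F) (auto simp: frame_homD[OF assms])

lemma frame_hom_ext:
  assumes "frame_hom g" "frame_hom h" "\<And>p q. g (ivl p q) = h (ivl p q)"
  shows "g = h"
proof
  fix x
  have "g (\<Squnion>F\<in>Rep_reals_frame x. \<Sqinter>(p, q)\<in>fset F. ivl p q) =
      h (\<Squnion>F\<in>Rep_reals_frame x. \<Sqinter>(p, q)\<in>fset F. ivl p q)"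
    unfolding frame_homD(3)[OF assms(1)] frame_homD(3)[OF assms(2)] image_image
      frame_hom_Inf_fset[OF assms(1)] frame_hom_Inf_fset[OF assms(2)] assms(3) ..
  then show "g x = h x" by (fold reals_frame_eq_Sup)
qed

definition respects_R :: "(rat \<Rightarrow> rat \<Rightarrow> 'a::frame) \<Rightarrow> bool" where
  "respects_R f \<longleftrightarrow>
     (\<forall>p q r s. f p q \<sqinter> f r s = f (max p r) (min q s)) \<and>
     (\<forall>p q r s. p \<le> r \<and> r < q \<and> q \<le> s \<longrightarrow> f p q \<squnion> f r s = f p s) \<and>
     (\<forall>p q. f p q = \<Squnion> {f r s | r s. p < r \<and> r < s \<and> s < q}) \<and>
     \<top> = \<Squnion> {f p q | p q. True}"

lemma frame_hom_respects_R:
  assumes "frame_hom h" shows "respects_R (\<lambda>p q. h (ivl p q))"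
  unfolding respects_R_def
proof (intro conjI allI impI)
  fix p q r s :: rat
  show "h (ivl p q) \<sqinter> h (ivl r s) = h (ivl (max p r) (min q s))"
    by (simp add: frame_homD(2)[OF assms, symmetric] ivl_R1)
  show "h (ivl p q) \<squnion> h (ivl r s) = h (ivl p s)" if "p \<le> r \<and> r < q \<and> q \<le> s"
    using that by (simp add: frame_homD(4)[OF assms, symmetric] ivl_R2)
  show "h (ivl p q) = \<Squnion> {h (ivl r s) | r s. p < r \<and> r < s \<and> s < q}"
    by (subst ivl_R3, subst frame_homD(3)[OF assms], rule arg_cong[of _ _ Sup]) auto
  show "\<top> = \<Squnion> {h (ivl p q) | p q. True}"
  proof -
    have "h \<top> = \<Squnion> {h (ivl p q) | p q. True}"
      by (subst ivl_R4, subst frame_homD(3)[OF assms], rule arg_cong[of _ _ Sup]) auto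
    then show ?thesis by (simp add: frame_homD(1)[OF assms])
  qed
qed

lemma inf_Sup_le_iff: "(x::'a::frame) \<sqinter> \<Squnion> A \<le> c \<longleftrightarrow> (\<forall>a\<in>A. x \<sqinter> a \<le> c)"
  by (auto simp: inf_Sup_frame Sup_le_iff)

lemma inf_sup_le_iff: "(x::'a::frame) \<sqinter> (a \<squnion> b) \<le> c \<longleftrightarrow> x \<sqinter> a \<le> c \<and> x \<sqinter> b \<le> c"
  using inf_Sup_le_iff[of x "{a, b}" c] by simp

lemma saturated_le:
  fixes f :: "rat \<Rightarrow> rat \<Rightarrow> 'a::frame"
  assumes "respects_R f"
  shows "saturated {F. (\<Sqinter>(p, q)\<in>fset F. f p q) \<le> c}"
proof -
  let ?m = "\<lambda>F. \<Sqinter>(p, q)\<in>fset F. f p q"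
  have ins: "?m (finsert (p, q) F) = ?m F \<sqinter> f p q" for p q and F :: "(rat \<times> rat) fset" by (simp add: inf_commute)
  have R1: "f p q \<sqinter> f r s = f (max p r) (min q s)" for p q r s
    using assms unfolding respects_R_def by blast
  have R2: "f p s = f p q \<squnion> f r s" if "p \<le> r" "r < q" "q \<le> s" for p q r s
    using assms that unfolding respects_R_def by metis
  have R3: "f p q = \<Squnion> {f r s | r s. p < r \<and> r < s \<and> s < q}" for p q
    using assms unfolding respects_R_def by blast
  have R4: "\<top> = \<Squnion> {f p q | p q. True}"
    using assms unfolding respects_R_def by blast
  show ?thesis
    unfolding saturated_def mem_Collect_eq
  proof (intro conjI allI impI)
    fix F G :: "(rat \<times> rat) fset" assume "?m F \<le> c" then show "?m (F |\<union>| G) \<le> c"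
      by (simp add: INF_union le_infI1)
  next
    fix F :: "(rat \<times> rat) fset" and p q r s :: rat
    show "?m (finsert (p, q) (finsert (r, s) F)) \<le> c \<longleftrightarrow> ?m (finsert (max p r, min q s) F) \<le> c"
      unfolding ins R1[symmetric] by (simp only: inf.assoc inf.commute[of "f r s" "f p q"])
  next
    fix F :: "(rat \<times> rat) fset" and p q r s :: rat assume "p \<le> r \<and> r < q \<and> q \<le> s"
    then show "?m (finsert (p, q) F) \<le> c \<and> ?m (finsert (r, s) F) \<le> c \<longleftrightarrow> ?m (finsert (p, s) F) \<le> c"
      unfolding ins by (simp add: R2[of p r q s] inf_sup_le_iff)
  next
    fix F :: "(rat \<times> rat) fset" and p q :: rat
    show "?m (finsert (p, q) F) \<le> c \<longleftrightarrow>
        (\<forall>r s. p < r \<and> r < s \<and> s < q \<longrightarrow> ?m (finsert (r, s) F) \<le> c)"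
    proof -
      have "?m F \<sqinter> f p q \<le> c \<longleftrightarrow>
          (\<forall>a\<in>{f r s | r s. p < r \<and> r < s \<and> s < q}. ?m F \<sqinter> a \<le> c)"
        unfolding R3[of p q] by (rule inf_Sup_le_iff)
      then show ?thesis unfolding ins by blast
    qed
  next
    fix F :: "(rat \<times> rat) fset"
    have "?m F \<sqinter> \<Squnion> {f p q | p q. True} \<le> c \<longleftrightarrow> (\<forall>a\<in>{f p q | p q. True}. ?m F \<sqinter> a \<le> c)"
      by (rule inf_Sup_le_iff)
    then have "?m F \<le> c \<longleftrightarrow> (\<forall>a\<in>{f p q | p q. True}. ?m F \<sqinter> a \<le> c)"
      unfolding R4[symmetric] by simp
    then show "?m F \<le> c \<longleftrightarrow> (\<forall>p q. ?m (finsert (p, q) F) \<le> c)"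
      unfolding ins by blast
  qed
qed

theorem presentation:
  fixes f :: "rat \<Rightarrow> rat \<Rightarrow> 'a::frame"
  assumes "respects_R f"
  shows "\<exists>!h. frame_hom h \<and> (\<forall>p q. h (ivl p q) = f p q)"
proof (rule ex_ex1I)
  let ?m = "\<lambda>F. \<Sqinter>(p, q)\<in>fset F. f p q"
  define h where "h x = (\<Squnion>F\<in>Rep_reals_frame x. ?m F)" for x
  have hull: "(\<Squnion>F\<in>saturated hull S. ?m F) = (\<Squnion>F\<in>S. ?m F)" for S
  proof (rule order.antisym)
    have "S \<subseteq> {F. ?m F \<le> (\<Squnion>F\<in>S. ?m F)}" by (auto intro: SUP_upper)
    then have "saturated hull S \<subseteq> {F. ?m F \<le> (\<Squnion>F\<in>S. ?m F)}"
      by (rule hull_minimal) (rule saturated_le[OF assms])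
    then show "(\<Squnion>F\<in>saturated hull S. ?m F) \<le> (\<Squnion>F\<in>S. ?m F)" by (blast intro: SUP_least)
  qed (rule SUP_subset_mono[OF hull_subset order_refl])
  have "h \<top> = \<top>"
  proof (rule top_le)
    show "\<top> \<le> h \<top>" unfolding h_def by (rule SUP_upper2[of "{||}"]) (auto simp: top_reals_frame.rep_eq)
  qed
  moreover have "h (x \<sqinter> y) = h x \<sqinter> h y" for x y
  proof (rule order.antisym)
    show "h (x \<sqinter> y) \<le> h x \<sqinter> h y"
      unfolding h_def inf_reals_frame.rep_eq by (intro le_infI SUP_subset_mono) auto
    have "?m G \<sqinter> ?m F \<le> h (x \<sqinter> y)" if "F \<in> Rep_reals_frame x" "G \<in> Rep_reals_frame y" for F G
    proof -
      have "F |\<union>| G \<in> Rep_reals_frame (x \<sqinter> y)"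
        using saturated_up[OF saturated_Rep that(1), of G] saturated_up[OF saturated_Rep that(2), of F]
        by (simp add: inf_reals_frame.rep_eq funion_commute)
      moreover have "?m G \<sqinter> ?m F \<le> ?m (F |\<union>| G)" by (simp add: INF_union inf_commute)
      ultimately show ?thesis unfolding h_def by (rule SUP_upper2)
    qed
    then have "h x \<sqinter> ?m G \<le> h (x \<sqinter> y)" if "G \<in> Rep_reals_frame y" for G
      using that by (subst inf_commute, subst h_def, subst inf_Sup_le_iff) blast
    then show "h x \<sqinter> h y \<le> h (x \<sqinter> y)"
      by (subst (2) h_def, subst inf_Sup_le_iff) blast
  qed
  moreover have "h (\<Squnion>A) = \<Squnion> (h ` A)" for A
    unfolding h_def Sup_reals_frame.rep_eq hull by (simp add: SUP_UNION)
  moreover have "h (ivl p q) = f p q" for p q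
    unfolding h_def ivl.rep_eq hull by simp
  ultimately show "\<exists>h. frame_hom h \<and> (\<forall>p q. h (ivl p q) = f p q)"
    unfolding frame_hom_def by blast
qed (metis frame_hom_ext)

lemma RL_of:
  assumes "respects_R f"
  shows "RL_of f \<in> RL" "RL_of f (ivl p q) = f p q"
  using theI'[OF presentation[OF assms]] by (auto simp: RL_of_def RL_def)


section \<open>The operations on real-valued functions are well defined\<close>

lemma inf_frame_le_Sup2:
  fixes A B :: "'a::frame set"
  assumes "\<And>a b. a \<in> A \<Longrightarrow> b \<in> B \<Longrightarrow> a \<sqinter> b \<le> c"
  shows "\<Squnion> A \<sqinter> \<Squnion> B \<le> c"
proof -
  have "b \<sqinter> \<Squnion> A \<le> c" if "b \<in> B" for b
    using assms that by (auto simp: inf_Sup_le_iff inf_commute)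
  then show ?thesis by (auto simp: inf_Sup_le_iff inf_commute)
qed

lemma respects_RD:
  assumes "respects_R f"
  shows "f p q \<sqinter> f r s = f (max p r) (min q s)"
    and "p \<le> r \<Longrightarrow> r < q \<Longrightarrow> q \<le> s \<Longrightarrow> f p q \<squnion> f r s = f p s"
    and "f p q = \<Squnion> {f r s | r s. p < r \<and> r < s \<and> s < q}"
    and "\<Squnion> {f p q | p q. True} = \<top>"
    and "q \<le> p \<Longrightarrow> f p q = \<bottom>"
proof -
  show "f p q \<sqinter> f r s = f (max p r) (min q s)"
    using assms unfolding respects_R_def by blast
  show "p \<le> r \<Longrightarrow> r < q \<Longrightarrow> q \<le> s \<Longrightarrow> f p q \<squnion> f r s = f p s"
    using assms unfolding respects_R_def by blast
  show 3: "f p q = \<Squnion> {f r s | r s. p < r \<and> r < s \<and> s < q}"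
    using assms unfolding respects_R_def by blast
  have "\<top> = \<Squnion> {f p q | p q. True}"
    using assms unfolding respects_R_def by blast
  then show "\<Squnion> {f p q | p q. True} = \<top>" by (rule sym)
  assume "q \<le> p"
  then have e: "{f r s | r s. p < r \<and> r < s \<and> s < q} = {}" by auto
  show "f p q = \<bottom>" by (subst 3, subst e) (rule Sup_empty)
qed

lemma respects_R_small:
  assumes f: "respects_R f" and e: "0 < e"
  shows "f p q \<le> \<Squnion> {f a b | a b. p \<le> a \<and> b \<le> q \<and> b - a < e}"
proof -
  have *: "f p q \<le> \<Squnion> {f a b | a b. p \<le> a \<and> b \<le> q \<and> b - a < e}" if "q - p < (3/2)^n * e" for n
    using that
  proof (induction n arbitrary: p q)
    case 0
    then show ?case by (intro Sup_upper) auto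
  next
    case (Suc n)
    show ?case
    proof (cases "p < q")
      case True
      define r where "r = p + (q - p) / 3"
      define s where "s = p + (q - p) * 2 / 3"
      have o: "p < r" "r < s" "s < q" using True by (simp_all add: r_def s_def field_simps)
      have l: "s - p < (3/2)^n * e" "q - r < (3/2)^n * e"
        using Suc.prems by (simp_all add: r_def s_def field_simps)
      have "f p s \<le> \<Squnion> {f a b | a b. p \<le> a \<and> b \<le> q \<and> b - a < e}"
        by (rule order_trans[OF Suc.IH[OF l(1)]], rule Sup_subset_mono) (use o in fastforce)
      moreover have "f r q \<le> \<Squnion> {f a b | a b. p \<le> a \<and> b \<le> q \<and> b - a < e}"
        by (rule order_trans[OF Suc.IH[OF l(2)]], rule Sup_subset_mono) (use o in fastforce)
      ultimately have "f p s \<squnion> f r q \<le> \<Squnion> {f a b | a b. p \<le> a \<and> b \<le> q \<and> b - a < e}"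
        by (rule le_supI)
      moreover have "f p s \<squnion> f r q = f p q"
        by (rule respects_RD(2)[OF f]) (use o in simp_all)
      ultimately show ?thesis by (simp only:)
    next
      case False
      then have "f p q = \<bottom>" by (intro respects_RD(5)[OF f]) simp
      then show ?thesis by (simp only: bot_least)
    qed
  qed
  obtain n where "(q - p) / e < of_nat n" using reals_Archimedean2 by blast
  moreover have "of_nat n \<le> (3/2 :: rat)^n"
  proof (induction n)
    case (Suc n)
    show ?case
    proof (cases "n < 2")
      case True then have "n = 0 \<or> n = 1" by auto
      then show ?thesis by auto
    next
      case False
      then have "of_nat n \<ge> (2::rat)" by (metis linorder_not_less of_nat_le_iff of_nat_numeral)
      with Suc show ?thesis by simp
    qed
  qed simp
  ultimately have "(q - p) / e < (3/2)^n" by linarith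
  then have "q - p < (3/2)^n * e" using e by (simp add: pos_divide_less_eq)
  then show ?thesis by (rule *)
qed

definition box_value ::
    "(rat \<Rightarrow> rat \<Rightarrow> 'a::frame) \<Rightarrow> (rat \<Rightarrow> rat \<Rightarrow> 'a) \<Rightarrow> (real \<times> real) set \<Rightarrow> 'a" where
  "box_value f g W = \<Squnion> {f r s \<sqinter> g u v | r s u v. ropen r s \<times> ropen u v \<subseteq> W}"

lemma box_value_mono: "W \<subseteq> W' \<Longrightarrow> box_value f g W \<le> box_value f g W'"
  unfolding box_value_def by (rule Sup_subset_mono) blast

lemma box_value_upper: "ropen r s \<times> ropen u v \<subseteq> W \<Longrightarrow> f r s \<sqinter> g u v \<le> box_value f g W"
  unfolding box_value_def by (rule Sup_upper) blast

lemma ropen_Int: "ropen p q \<inter> ropen r s = ropen (max p r) (min q s)"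
  by (auto simp: ropen_def max_def min_def of_rat_less of_rat_less_eq)

lemma box_value_Int:
  assumes "respects_R f" "respects_R g"
  shows "box_value f g (W \<inter> W') = box_value f g W \<sqinter> box_value f g W'"
proof (rule order.antisym)
  show "box_value f g W \<sqinter> box_value f g W' \<le> box_value f g (W \<inter> W')"
    unfolding box_value_def[of f g W] box_value_def[of f g W']
  proof (rule inf_frame_le_Sup2, clarify)
    fix r s u v r' s' u' v'
    assume "ropen r s \<times> ropen u v \<subseteq> W" "ropen r' s' \<times> ropen u' v' \<subseteq> W'"
    then have "ropen (max r r') (min s s') \<times> ropen (max u u') (min v v') \<subseteq> W \<inter> W'"
      unfolding ropen_Int[symmetric] by blast
    then have "f (max r r') (min s s') \<sqinter> g (max u u') (min v v') \<le> box_value f g (W \<inter> W')"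
      by (rule box_value_upper)
    moreover have "(f r s \<sqinter> g u v) \<sqinter> (f r' s' \<sqinter> g u' v') = (f r s \<sqinter> f r' s') \<sqinter> (g u v \<sqinter> g u' v')"
      by (simp add: inf_assoc inf_left_commute)
    ultimately show "f r s \<sqinter> g u v \<sqinter> (f r' s' \<sqinter> g u' v') \<le> box_value f g (W \<inter> W')"
      by (simp add: respects_RD(1)[OF assms(1)] respects_RD(1)[OF assms(2)])
  qed
qed (simp add: box_value_mono)

lemma box_value_UNIV:
  assumes "respects_R f" "respects_R g" shows "box_value f g UNIV = \<top>"
proof (rule top_le)
  have "\<Squnion> {f p q | p q. True} \<sqinter> \<Squnion> {g p q | p q. True} \<le> box_value f g UNIV"
    by (rule inf_frame_le_Sup2) (auto intro: box_value_upper)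
  then show "\<top> \<le> box_value f g UNIV"
    unfolding respects_RD(4)[OF assms(1)] respects_RD(4)[OF assms(2)] by simp
qed

lemma box_value_Union:
  assumes f: "respects_R f" and g: "respects_R g" and op: "\<And>W. W \<in> \<W> \<Longrightarrow> open W"
  shows "box_value f g (\<Union>\<W>) = (\<Squnion>W\<in>\<W>. box_value f g W)"
proof (rule order.antisym)
  let ?S = "\<Squnion>W\<in>\<W>. box_value f g W"
  have main: "f r' s' \<sqinter> g u' v' \<le> ?S"
    if sub: "ropen r s \<times> ropen u v \<subseteq> \<Union>\<W>"
      and o: "r < r'" "r' < s'" "s' < s" "u < u'" "u' < v'" "v' < v"
    for r s u v r' s' u' v'
  proof -
    let ?K = "{of_rat r' .. of_rat s' :: real} \<times> {of_rat u' .. of_rat v' :: real}"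
    have "(of_rat r :: real) < of_rat r'" "(of_rat s' :: real) < of_rat s"
      "(of_rat u :: real) < of_rat u'" "(of_rat v' :: real) < of_rat v"
      using o by (simp_all add: of_rat_less)
    then have "?K \<subseteq> ropen r s \<times> ropen u v" by (auto simp: ropen_def)
    with sub have K: "?K \<subseteq> \<Union>\<W>" by blast
    have "compact ?K" by (intro compact_Times compact_Icc)
    then obtain e where e: "0 < e"
      and leb: "\<And>T. T \<subseteq> ?K \<Longrightarrow> diameter T < e \<Longrightarrow> \<exists>W\<in>\<W>. T \<subseteq> W"
    proof (rule Lebesgue_number_lemma)
      show "\<W> \<noteq> {}"
      proof
        assume "\<W> = {}"
        with K have "?K = {}" by simp
        with o show False by (auto simp: of_rat_less_eq)
      qed
    qed (use K op in auto)
    have "0 < e / 3" using e by simp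
    then obtain d where d: "(0::real) < of_rat d" "of_rat d < e / 3"
      using of_rat_dense by blast
    have d0: "0 < d" using d(1) by simp
    have small: "f a b \<sqinter> g a' b' \<le> ?S"
      if "r' \<le> a" "b \<le> s'" "b - a < d" "u' \<le> a'" "b' \<le> v'" "b' - a' < d" for a b a' b'
    proof -
      let ?T = "ropen a b \<times> ropen a' b'"
      have l: "(of_rat b :: real) - of_rat a < of_rat d" "(of_rat b' :: real) - of_rat a' < of_rat d"
        using that by (simp_all add: of_rat_less flip: of_rat_diff)
      have "(of_rat r' :: real) \<le> of_rat a" "(of_rat b :: real) \<le> of_rat s'"
        "(of_rat u' :: real) \<le> of_rat a'" "(of_rat b' :: real) \<le> of_rat v'"
        using that by (simp_all add: of_rat_less_eq)
      then have "?T \<subseteq> ?K" by (auto simp: ropen_def)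
      moreover have "diameter ?T < e"
      proof -
        have "diameter ?T \<le> 2 * of_rat d"
        proof (rule diameter_le)
          fix x y assume xy: "x \<in> ?T" "y \<in> ?T"
          have "norm (x - y) \<le> norm (fst (x - y)) + norm (snd (x - y))"
            by (metis norm_Pair_le prod.collapse)
          also have "\<dots> \<le> 2 * of_rat d"
            using xy l by (auto simp: ropen_def)
          finally show "norm (x - y) \<le> 2 * of_rat d" .
        qed (use d in auto)
        also have "\<dots> < e" using d by linarith
        finally show ?thesis .
      qed
      ultimately obtain W where "W \<in> \<W>" "?T \<subseteq> W" using leb by blast
      show ?thesis by (rule SUP_upper2[OF \<open>W \<in> \<W>\<close>]) (rule box_value_upper[OF \<open>?T \<subseteq> W\<close>])
    qed
    have "f r' s' \<sqinter> g u' v' \<le> \<Squnion> {f a b | a b. r' \<le> a \<and> b \<le> s' \<and> b - a < d}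
        \<sqinter> \<Squnion> {g a b | a b. u' \<le> a \<and> b \<le> v' \<and> b - a < d}"
      by (intro inf_mono respects_R_small f g d0)
    also have "\<dots> \<le> ?S"
      by (rule inf_frame_le_Sup2) (use small in blast)
    finally show ?thesis .
  qed
  show "box_value f g (\<Union>\<W>) \<le> ?S"
    unfolding box_value_def[of f g "\<Union>\<W>"]
  proof (rule Sup_least, clarify)
    fix r s u v assume sub: "ropen r s \<times> ropen u v \<subseteq> \<Union>\<W>"
    show "f r s \<sqinter> g u v \<le> ?S"
      by (subst respects_RD(3)[OF f], subst respects_RD(3)[OF g], rule inf_frame_le_Sup2)
        (use main[OF sub] in blast)
  qed
  show "?S \<le> box_value f g (\<Union>\<W>)"
    by (rule SUP_least) (blast intro: box_value_mono)
qed

lemma ropen_R2: "p \<le> r \<Longrightarrow> r < q \<Longrightarrow> q \<le> s \<Longrightarrow> ropen p q \<union> ropen r s = ropen p s"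
proof -
  assume "p \<le> r" "r < q" "q \<le> s"
  then have "(of_rat p :: real) \<le> of_rat r" "(of_rat r :: real) < of_rat q" "(of_rat q :: real) \<le> of_rat s"
    by (simp_all add: of_rat_less of_rat_less_eq)
  then show ?thesis by (auto simp: ropen_def)
qed

lemma ropen_R3: "ropen p q = \<Union> {ropen r s | r s. p < r \<and> r < s \<and> s < q}"
proof
  show "ropen p q \<subseteq> \<Union> {ropen r s | r s. p < r \<and> r < s \<and> s < q}"
  proof
    fix x assume "x \<in> ropen p q"
    then have "of_rat p < x" "x < of_rat q" by (auto simp: ropen_def)
    then obtain r s where "of_rat p < (of_rat r :: real)" "of_rat r < x" "x < of_rat s"
      "of_rat s < (of_rat q :: real)" using of_rat_dense by metis
    moreover from this have "(of_rat r :: real) < of_rat s" by linarith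
    ultimately have "x \<in> ropen r s" "p < r" "r < s" "s < q"
      by (simp_all add: of_rat_less ropen_def)
    then show "x \<in> \<Union> {ropen r s | r s. p < r \<and> r < s \<and> s < q}" by blast
  qed
  show "\<Union> {ropen r s | r s. p < r \<and> r < s \<and> s < q} \<subseteq> ropen p q"
  proof clarify
    fix x r s assume "x \<in> ropen r s" "p < r" "s < q"
    moreover then have "(of_rat p :: real) < of_rat r" "(of_rat s :: real) < of_rat q"
      by (simp_all add: of_rat_less)
    ultimately show "x \<in> ropen p q" by (auto simp: ropen_def)
  qed
qed

lemma ropen_R4: "\<Union> {ropen r s | r s. True} = UNIV"
proof -
  have "x \<in> \<Union> {ropen r s | r s. True}" for x :: real
  proof -
    obtain r s where "of_rat r < x" "x < of_rat s"
      using of_rat_dense[of "x - 1" x] of_rat_dense[of x "x + 1"] by auto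
    then have "x \<in> ropen r s" by (simp add: ropen_def)
    then show ?thesis by blast
  qed
  then show ?thesis by blast
qed

lemma RL_op_respects_R:
  fixes \<alpha> \<beta> :: "reals_frame \<Rightarrow> 'a::frame" and d :: "real \<Rightarrow> real \<Rightarrow> real"
  assumes "\<alpha> \<in> RL" "\<beta> \<in> RL" and d: "continuous_on UNIV (\<lambda>(x, y). d x y)"
  shows "respects_R (\<lambda>p q.
    \<Squnion> {\<alpha> (ivl r s) \<sqinter> \<beta> (ivl u v) | r s u v. {d x y | x y. x \<in> ropen r s \<and> y \<in> ropen u v} \<subseteq> ropen p q})"
proof -
  let ?f = "\<lambda>p q. \<alpha> (ivl p q)" and ?g = "\<lambda>p q. \<beta> (ivl p q)"
  let ?V = "\<lambda>X. (\<lambda>(x, y). d x y) -` X"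
  let ?h = "\<lambda>p q. box_value ?f ?g (?V (ropen p q))"
  have f: "respects_R ?f" and g: "respects_R ?g"
    using assms by (auto simp: RL_def intro: frame_hom_respects_R)
  have op: "open (?V (ropen p q))" for p q
    using d by (simp add: continuous_on_open_vimage ropen_def)
  have "{d x y | x y. x \<in> X \<and> y \<in> Y} \<subseteq> Z \<longleftrightarrow> X \<times> Y \<subseteq> ?V Z" for X Y Z by auto blast
  then have *: "(\<lambda>p q. \<Squnion> {\<alpha> (ivl r s) \<sqinter> \<beta> (ivl u v) | r s u v.
      {d x y | x y. x \<in> ropen r s \<and> y \<in> ropen u v} \<subseteq> ropen p q}) = ?h"
    by (simp add: box_value_def)
  show ?thesis
    unfolding * respects_R_def
  proof (intro conjI allI impI)
    fix p q r s :: rat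
    show "?h p q \<sqinter> ?h r s = ?h (max p r) (min q s)"
      by (simp add: box_value_Int[OF f g, symmetric] vimage_Int[symmetric] ropen_Int)
    show "?h p q \<squnion> ?h r s = ?h p s" if "p \<le> r \<and> r < q \<and> q \<le> s"
    proof -
      have "box_value ?f ?g (\<Union> {?V (ropen p q), ?V (ropen r s)}) =
          (\<Squnion>W\<in>{?V (ropen p q), ?V (ropen r s)}. box_value ?f ?g W)"
        by (rule box_value_Union[OF f g]) (use op in blast)
      moreover have "\<Union> {?V (ropen p q), ?V (ropen r s)} = ?V (ropen p s)"
        using ropen_R2[of p r q s] that by blast
      ultimately show ?thesis by simp
    qed
    show "?h p q = \<Squnion> {?h r s | r s. p < r \<and> r < s \<and> s < q}"
    proof -
      let ?W = "{?V (ropen r s) | r s. p < r \<and> r < s \<and> s < q}"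
      have "?V (ropen p q) = \<Union> ?W" by (subst ropen_R3) blast
      then have "?h p q = box_value ?f ?g (\<Union> ?W)" by (rule arg_cong)
      also have "\<dots> = (\<Squnion>W\<in>?W. box_value ?f ?g W)"
        by (rule box_value_Union[OF f g]) (use op in blast)
      also have "box_value ?f ?g ` ?W = {?h r s | r s. p < r \<and> r < s \<and> s < q}" by blast
      finally show ?thesis .
    qed
    show "\<top> = \<Squnion> {?h p q | p q. True}"
    proof -
      let ?W = "{?V (ropen r s) | r s. True}"
      have "\<Union> ?W = ?V (\<Union> {ropen r s | r s. True})" by blast
      then have "\<Union> ?W = UNIV" by (simp only: ropen_R4 vimage_UNIV)
      then have "\<top> = box_value ?f ?g (\<Union> ?W)" using box_value_UNIV[OF f g] by simp
      also have "\<dots> = (\<Squnion>W\<in>?W. box_value ?f ?g W)"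
        by (rule box_value_Union[OF f g]) (use op in blast)
      also have "box_value ?f ?g ` ?W = {?h r s | r s. True}" by blast
      finally show ?thesis .
    qed
  qed
qed

lemma RL_op:
  assumes "\<alpha> \<in> RL" "\<beta> \<in> RL" "continuous_on UNIV (\<lambda>(x, y). d x y)"
  shows "RL_op d \<alpha> \<beta> \<in> RL"
    and "RL_op d \<alpha> \<beta> (ivl p q) =
      \<Squnion> {\<alpha> (ivl r s) \<sqinter> \<beta> (ivl u v) | r s u v. {d x y | x y. x \<in> ropen r s \<and> y \<in> ropen u v} \<subseteq> ropen p q}"
  unfolding RL_op_def using RL_of[OF RL_op_respects_R[OF assms]] by auto

lemma RL_const:
  shows "(RL_const r :: reals_frame \<Rightarrow> 'a::frame) \<in> RL"
    and "RL_const r (ivl p q) = (if of_rat p < r \<and> r < of_rat q then \<top> else \<bottom> :: 'a::frame)"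
proof -
  let ?f = "\<lambda>p q. if of_rat p < r \<and> r < of_rat q then \<top> else \<bottom> :: 'a"
  have f: "?f p q = (if r \<in> ropen p q then \<top> else \<bottom>)" for p q by (simp add: ropen_def)
  have Sup: "\<Squnion> {if r \<in> X then \<top> else \<bottom> :: 'a | X. X \<in> A} = (if r \<in> \<Union>A then \<top> else \<bottom>)" for A
  proof (cases "r \<in> \<Union>A")
    case True
    then have "\<top> \<in> {if r \<in> X then \<top> else \<bottom> :: 'a | X. X \<in> A}" by force
    then have "\<top> \<le> \<Squnion> {if r \<in> X then \<top> else \<bottom> :: 'a | X. X \<in> A}" by (rule Sup_upper)
    then have "\<Squnion> {if r \<in> X then \<top> else \<bottom> :: 'a | X. X \<in> A} = \<top>" by (rule top_le)
    then show ?thesis using True by (simp only: if_True)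
  next
    case False
    then have "\<Squnion> {if r \<in> X then \<top> else \<bottom> :: 'a | X. X \<in> A} \<le> \<bottom>" by (intro Sup_least) auto
    then have "\<Squnion> {if r \<in> X then \<top> else \<bottom> :: 'a | X. X \<in> A} = \<bottom>"
      by (rule bot_unique[THEN iffD1])
    then show ?thesis using False by (simp only: if_False)
  qed
  have R: "respects_R ?f"
    unfolding respects_R_def
  proof (intro conjI allI impI)
    fix p q u s :: rat
    show "?f p q \<sqinter> ?f u s = ?f (max p u) (min q s)"
      unfolding f ropen_Int[symmetric] by simp
    show "?f p q \<squnion> ?f u s = ?f p s" if "p \<le> u \<and> u < q \<and> q \<le> s"
      unfolding f using ropen_R2[of p u q s] that by auto
    have "\<Squnion> {?f u s | u s. p < u \<and> u < s \<and> s < q} =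
        \<Squnion> {if r \<in> X then \<top> else \<bottom> :: 'a | X. X \<in> {ropen u s | u s. p < u \<and> u < s \<and> s < q}}"
      unfolding f by (rule arg_cong[of _ _ Sup]) blast
    then show "?f p q = \<Squnion> {?f u s | u s. p < u \<and> u < s \<and> s < q}"
      unfolding Sup ropen_R3[symmetric] f by simp
    have "\<Squnion> {?f u s | u s. True} =
        \<Squnion> {if r \<in> X then \<top> else \<bottom> :: 'a | X. X \<in> {ropen u s | u s. True}}"
      unfolding f by (rule arg_cong[of _ _ Sup]) blast
    then show "\<top> = \<Squnion> {?f u s | u s. True}"
      unfolding Sup ropen_R4 by simp
  qed
  show "(RL_const r :: reals_frame \<Rightarrow> 'a::frame) \<in> RL"
    unfolding RL_const_def by (rule RL_of(1)[OF R])
  show "RL_const r (ivl p q) = (if of_rat p < r \<and> r < of_rat q then \<top> else \<bottom> :: 'a)"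
    unfolding RL_const_def by (rule RL_of(2)[OF R])
qed

lemma RL_uminus:
  fixes \<alpha> :: "reals_frame \<Rightarrow> 'a::frame"
  assumes "\<alpha> \<in> RL"
  shows "RL_uminus \<alpha> \<in> RL" "RL_uminus \<alpha> (ivl p q) = \<alpha> (ivl (- q) (- p))"
proof -
  let ?f = "\<lambda>p q. \<alpha> (ivl p q)"
  have f: "respects_R ?f" using assms by (auto simp: RL_def intro: frame_hom_respects_R)
  have "respects_R (\<lambda>p q. ?f (- q) (- p))"
    unfolding respects_R_def
  proof (intro conjI allI impI)
    fix p q r s :: rat
    have "max (- q) (- s) = - min q s" "min (- p) (- r) = - max p r" 
      by (simp_all add: minus_min_eq_max minus_max_eq_min)
    then show "?f (- q) (- p) \<sqinter> ?f (- s) (- r) = ?f (- min q s) (- max p r)"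
      using respects_RD(1)[OF f] by simp
    show "?f (- q) (- p) \<squnion> ?f (- s) (- r) = ?f (- s) (- p)" if "p \<le> r \<and> r < q \<and> q \<le> s"
      using respects_RD(2)[OF f, of "- s" "- q" "- r" "- p"] that by (simp add: sup_commute)
    have "{?f (- s) (- r) | r s. p < r \<and> r < s \<and> s < q} = {?f r s | r s. - q < r \<and> r < s \<and> s < - p}"
      
      (is "?A = ?B")
    proof
      show "?A \<subseteq> ?B" by force
      show "?B \<subseteq> ?A"
      proof clarify
        fix r s assume "- q < r" "r < s" "s < - p"
        then show "\<exists>r' s'. ?f r s = ?f (- s') (- r') \<and> p < r' \<and> r' < s' \<and> s' < q"
          by (intro exI[of _ "- s"] exI[of _ "- r"]) simp
      qed
    qed
    then show "?f (- q) (- p) = \<Squnion> ?A" by (simp only: respects_RD(3)[OF f, of "- q" "- p"])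
    have "\<Squnion> {?f p q | p q. True} \<le> \<Squnion> {?f (- q) (- p) | p q. True}"
    proof (rule Sup_least, clarify)
      fix p q
      have "?f p q = ?f (- (- p)) (- (- q))" by simp
      then have "?f p q \<in> {?f (- q) (- p) | p q. True}" by blast
      then show "?f p q \<le> \<Squnion> {?f (- q) (- p) | p q. True}" by (rule Sup_upper)
    qed
    then show "\<top> = \<Squnion> {?f (- q) (- p) | p q. True}"
      unfolding respects_RD(4)[OF f] by (rule top_le[symmetric])
  qed
  then show "RL_uminus \<alpha> \<in> RL" "RL_uminus \<alpha> (ivl p q) = \<alpha> (ivl (- q) (- p))"
    unfolding RL_uminus_def by (simp_all add: RL_of)
qed

lemma continuous_on_plus: "continuous_on UNIV (\<lambda>(x, y). x + y :: real)"
  unfolding case_prod_unfold by (intro continuous_intros)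

lemma RL_minus: "\<alpha> \<in> RL \<Longrightarrow> \<beta> \<in> RL \<Longrightarrow> RL_minus \<alpha> \<beta> \<in> RL"
  by (simp add: RL_minus_def RL_op(1) RL_uminus(1) continuous_on_plus)

lemma RL_add_uminus:
  fixes \<alpha> :: "reals_frame \<Rightarrow> 'a::frame"
  assumes "\<alpha> \<in> RL"
  shows "RL_op (+) \<alpha> (RL_uminus \<alpha>) = RL_const 0"
proof (rule frame_hom_ext)
  note u = RL_uminus[OF assms]
  show "frame_hom (RL_op (+) \<alpha> (RL_uminus \<alpha>))" "frame_hom (RL_const 0 :: reals_frame \<Rightarrow> 'a)"
    using RL_op(1)[OF assms u(1) continuous_on_plus] RL_const(1) by (auto simp: RL_def)
  let ?f = "\<lambda>p q. \<alpha> (ivl p q)"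
  have f: "respects_R ?f" using assms by (auto simp: RL_def intro: frame_hom_respects_R)
  fix p q
  define S where "S = {\<alpha> (ivl r s) \<sqinter> \<alpha> (ivl (- v) (- u)) | r s u v.
      {x + y | x y. x \<in> ropen r s \<and> y \<in> ropen u v} \<subseteq> ropen p q}"
  have eq: "RL_op (+) \<alpha> (RL_uminus \<alpha>) (ivl p q) = \<Squnion> S"
    unfolding RL_op(2)[OF assms u(1) continuous_on_plus] u(2) S_def ..
  show "RL_op (+) \<alpha> (RL_uminus \<alpha>) (ivl p q) = RL_const 0 (ivl p q)"
  proof (cases "p < 0 \<and> 0 < q")
    case True
    define e where "e = min (- p) q"
    have e: "0 < e" using True by (simp add: e_def)
    have "?f a b \<le> \<Squnion> S" if "b - a < e" for a b
    proof (rule Sup_upper)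
      have "(of_rat b - of_rat a :: real) < of_rat e"
        using that by (simp add: of_rat_less flip: of_rat_diff)
      moreover have "(of_rat e :: real) \<le> of_rat (- p)" "(of_rat e :: real) \<le> of_rat q"
        unfolding of_rat_less_eq by (simp_all add: e_def)
      ultimately have sub: "{x + y | x y. x \<in> ropen a b \<and> y \<in> ropen (- b) (- a)} \<subseteq> ropen p q"
        by (auto simp: ropen_def of_rat_minus)
      have "?f a b = \<alpha> (ivl a b) \<sqinter> \<alpha> (ivl (- (- a)) (- (- b)))" by simp
      with sub show "?f a b \<in> S" unfolding S_def by blast
    qed
    then have "?f a b \<le> \<Squnion> S" for a b
      by (intro order_trans[OF respects_R_small[OF f e, of a b]] Sup_least) blast
    then have "\<Squnion> {?f p q | p q. True} \<le> \<Squnion> S" by (intro Sup_least) blast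
    then have "\<Squnion> S = \<top>" unfolding respects_RD(4)[OF f] by (rule top_le)
    then show ?thesis using True by (simp add: eq RL_const(2))
  next
    case False
    have "x = \<bottom>" if xS: "x \<in> S" for x
    proof -
      obtain r s u v where x: "x = \<alpha> (ivl r s) \<sqinter> \<alpha> (ivl (- v) (- u))"
        and sub: "{x + y | x y. x \<in> ropen r s \<and> y \<in> ropen u v} \<subseteq> ropen p q"
        using xS unfolding S_def by blast
      have le: "min s (- u) \<le> max r (- v)"
      proof (rule ccontr)
        assume "\<not> ?thesis"
        then have "max r (- v) < min s (- u)" by (simp only: not_le)
        then obtain t where "max r (- v) < t" "t < min s (- u)" using dense by blast
        then have "r < t" "t < s" "u < - t" "- t < v" by simp_all
        then have "of_rat t \<in> ropen r s" "of_rat (- t) \<in> ropen u v"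
          by (simp_all only: ropen_def greaterThanLessThan_iff of_rat_less)
        then have "of_rat t + of_rat (- t) \<in> ropen p q" using sub by blast
        then show False using False by (simp add: ropen_def of_rat_minus)
      qed
      show ?thesis
        unfolding x respects_RD(1)[OF f] by (rule respects_RD(5)[OF f le])
    qed
    then have "\<Squnion> S \<le> \<bottom>" by (intro Sup_least) auto
    then have "\<Squnion> S = \<bottom>" by (rule bot_unique[THEN iffD1])
    moreover have "RL_const 0 (ivl p q) = (\<bottom> :: 'a)" unfolding RL_const(2) using False by auto
    ultimately show ?thesis by (simp only: eq)
  qed
qed

end

theory Submission
  imports Defs
begin

text \<open>If \<open>a\<close> has the complement \<open>b\<close>, then \<open>a\<close> is the cozero element of the function
  with value \<open>1\<close> on \<open>a\<close> and \<open>0\<close> on \<open>b\<close>, whose range lies in \<open>{0, 1}\<close>. Conversely, \<open>coz (\<alpha> - r)\<close>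
  is the join of the disjoint elements \<open>\<alpha>(-, r)\<close> and \<open>\<alpha>(r, -)\<close>, so both are
  complemented for every real \<open>r\<close> outside \<open>R\<^sub>\<alpha>\<close>. If \<open>R\<^sub>\<alpha>\<close> is countable, its complement is
  dense, and \<open>\<alpha>(0, -)\<close> and \<open>\<alpha>(-, 0)\<close> are joins of such elements.\<close>

section \<open>Distributivity, bases and gluing of homomorphisms in frames\<close>

lemma inf_sup_distrib_frame: "(x::'a::frame) \<sqinter> (a \<squnion> b) = (x \<sqinter> a) \<squnion> (x \<sqinter> b)"
  using inf_Sup_frame[of x "{a, b}"] by simp

lemma inf_sup_distrib_frame': "(a \<squnion> b) \<sqinter> (x::'a::frame) = (a \<sqinter> x) \<squnion> (b \<sqinter> x)"
  using inf_sup_distrib_frame[of x a b] by (simp only: inf_commute)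

text \<open>If any subset of \<open>B\<close> has join \<open>a\<close>, it consists of elements
  below \<open>a\<close>, so the set of all such elements works as well. This canonical choice
  replaces the existential witness by an inequality.\<close>

lemma is_base_iff_le: "is_base B \<longleftrightarrow> (\<forall>a. a \<le> \<Squnion> {c \<in> B. c \<le> a})"
proof
  assume B: "is_base B"
  show "\<forall>a. a \<le> \<Squnion> {c \<in> B. c \<le> a}"
  proof
    fix a
    obtain S where "S \<subseteq> B" "a = \<Squnion> S" using B unfolding is_base_def by blast
    then have "S \<subseteq> {c \<in> B. c \<le> a}" by (auto intro: Sup_upper)
    then have "\<Squnion> S \<le> \<Squnion> {c \<in> B. c \<le> a}" by (rule Sup_subset_mono)
    then show "a \<le> \<Squnion> {c \<in> B. c \<le> a}" by (simp only: \<open>a = \<Squnion> S\<close>)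
  qed
next
  assume le: "\<forall>a. a \<le> \<Squnion> {c \<in> B. c \<le> a}"
  show "is_base B"
    unfolding is_base_def
  proof
    fix a
    show "\<exists>S\<subseteq>B. a = \<Squnion> S"
    proof (intro exI conjI)
      show "{c \<in> B. c \<le> a} \<subseteq> B" by (rule Collect_restrict)
      show "a = \<Squnion> {c \<in> B. c \<le> a}"
        by (rule order.antisym[OF le[rule_format]], rule Sup_least) simp
    qed
  qed
qed

lemma is_base_superset: "is_base A \<Longrightarrow> A \<subseteq> B \<Longrightarrow> is_base B"
  unfolding is_base_def by (meson subset_trans)

text \<open>Approximations from \<open>B\<close> of an \<open>a\<close> below \<open>x\<close> also
  lie below \<open>x\<close>, so approximating the members of \<open>A\<close> suffices. Below,
  \<open>A\<close> is \<open>Coz_c\<close> and \<open>B\<close> is the set of complemented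
  elements.\<close>

lemma is_base_refine:
  assumes A: "is_base A" and le: "\<And>a. a \<in> A \<Longrightarrow> a \<le> \<Squnion> {c \<in> B. c \<le> a}"
  shows "is_base B"
  unfolding is_base_iff_le
proof
  fix x
  have "a \<le> \<Squnion> {c \<in> B. c \<le> x}" if "a \<in> A" "a \<le> x" for a
    by (rule order_trans[OF le[OF that(1)]], rule Sup_subset_mono) (use that(2) in \<open>auto intro: order_trans\<close>)
  then have "\<Squnion> {a \<in> A. a \<le> x} \<le> \<Squnion> {c \<in> B. c \<le> x}" by (intro Sup_least) blast
  moreover have "x \<le> \<Squnion> {a \<in> A. a \<le> x}" using A[unfolded is_base_iff_le] ..
  ultimately show "x \<le> \<Squnion> {c \<in> B. c \<le> x}" by (rule order_trans[rotated])
qed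

text \<open>A complemented pair splits the codomain as a product of the parts below \<open>a\<close>
  and below \<open>b\<close>, and a homomorphism may be prescribed on each. Meets are preserved
  because the cross terms lie below \<open>a \<sqinter> b = \<bottom>\<close>. Gluing two constants
  this way yields a step function without checking (R1)--(R4) again.\<close>

lemma frame_hom_glue:
  fixes a b :: "'b::frame" and g h :: "'a::frame \<Rightarrow> 'b"
  assumes ab: "a \<sqinter> b = \<bottom>" "a \<squnion> b = \<top>" and g: "frame_hom g" and h: "frame_hom h"
  shows "frame_hom (\<lambda>x. (a \<sqinter> g x) \<squnion> (b \<sqinter> h x))"
  unfolding frame_hom_def
proof (intro conjI allI)
  show "(a \<sqinter> g \<top>) \<squnion> (b \<sqinter> h \<top>) = \<top>"
    by (simp add: frame_homD[OF g] frame_homD[OF h] ab)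
next
  fix x y
  have disj: "(a \<sqinter> u) \<sqinter> (b \<sqinter> v) = \<bottom>" for u v
  proof -
    have "(a \<sqinter> u) \<sqinter> (b \<sqinter> v) = (a \<sqinter> b) \<sqinter> (u \<sqinter> v)" by (simp only: inf_assoc inf_left_commute)
    then show ?thesis by (simp add: ab(1))
  qed
  moreover have "(b \<sqinter> u) \<sqinter> (a \<sqinter> v) = \<bottom>" for u v
    using disj[of v u] by (simp only: inf_commute)
  moreover have "(c \<sqinter> u) \<sqinter> (c \<sqinter> v) = c \<sqinter> (u \<sqinter> v)" for c u v :: 'b
    by (simp add: inf_assoc inf_left_commute)
  ultimately have "((a \<sqinter> u) \<squnion> (b \<sqinter> v)) \<sqinter> ((a \<sqinter> u') \<squnion> (b \<sqinter> v'))
      = (a \<sqinter> (u \<sqinter> u')) \<squnion> (b \<sqinter> (v \<sqinter> v'))" for u v u' v'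
    by (simp add: inf_sup_distrib_frame inf_sup_distrib_frame')
  then show "(a \<sqinter> g (x \<sqinter> y)) \<squnion> (b \<sqinter> h (x \<sqinter> y))
      = ((a \<sqinter> g x) \<squnion> (b \<sqinter> h x)) \<sqinter> ((a \<sqinter> g y) \<squnion> (b \<sqinter> h y))"
    by (simp add: frame_homD(2)[OF g] frame_homD(2)[OF h])
next
  fix A
  show "(a \<sqinter> g (\<Squnion>A)) \<squnion> (b \<sqinter> h (\<Squnion>A)) = \<Squnion> ((\<lambda>x. (a \<sqinter> g x) \<squnion> (b \<sqinter> h x)) ` A)"
    by (simp add: frame_homD(3)[OF g] frame_homD(3)[OF h] inf_Sup_frame image_image complete_lattice_class.SUP_sup_distrib)
qed

section \<open>Lower and upper cuts of a real-valued function\<close>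

definition RL_above :: "(reals_frame \<Rightarrow> 'a::frame) \<Rightarrow> real \<Rightarrow> 'a" where
  "RL_above \<alpha> r = \<Squnion> {\<alpha> (ivl p q) | p q. r < of_rat p}"

text \<open>Both cuts take a real cut point, unlike \<open>ivl_above\<close> and
  \<open>ivl_below\<close>, because they are compared with \<open>R_set\<close>, a set of reals. One
  endpoint is left free: for \<alpha> in \<open>RL\<close>, intervals with endpoints out of order
  only contribute \<bottom>.\<close>

definition RL_below :: "(reals_frame \<Rightarrow> 'a::frame) \<Rightarrow> real \<Rightarrow> 'a" where
  "RL_below \<alpha> r = \<Squnion> {\<alpha> (ivl p q) | p q. of_rat q < r}"

lemma RL_above_upper: "r < of_rat p \<Longrightarrow> \<alpha> (ivl p q) \<le> RL_above \<alpha> r"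
  unfolding RL_above_def by (rule Sup_upper) blast

lemma RL_below_upper: "of_rat q < r \<Longrightarrow> \<alpha> (ivl p q) \<le> RL_below \<alpha> r"
  unfolding RL_below_def by (rule Sup_upper) blast

lemma RL_above_antimono: "r \<le> s \<Longrightarrow> RL_above \<alpha> s \<le> RL_above \<alpha> r"
  unfolding RL_above_def by (rule Sup_subset_mono) force

lemma RL_below_mono: "r \<le> s \<Longrightarrow> RL_below \<alpha> r \<le> RL_below \<alpha> s"
  unfolding RL_below_def by (rule Sup_subset_mono) force

context
  fixes \<alpha> :: "reals_frame \<Rightarrow> 'a::frame"
  assumes \<alpha>: "\<alpha> \<in> RL"
begin

lemma RL_frame_hom: "frame_hom \<alpha>"
  using \<alpha> by (simp add: RL_def)

lemmas RL_respects = respects_RD[OF frame_hom_respects_R[OF RL_frame_hom]]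

text \<open>The two joins differ only in generators with \<open>s \<le> r\<close>, which \<alpha>
  sends to \<bottom>; otherwise \<open>p < r < s\<close> gives the missing condition on
  \<open>s\<close>.\<close>

lemma RL_ivl_above: "\<alpha> (ivl_above p) = RL_above \<alpha> (of_rat p)"
proof -
  have eq: "\<alpha> (ivl_above p) = \<Squnion> {\<alpha> (ivl r s) | r s. p < r \<and> p < s}"
    unfolding ivl_above_def frame_homD(3)[OF RL_frame_hom]
    by (rule arg_cong[of _ _ Sup]) blast
  show ?thesis
  proof (rule order.antisym)
    show "\<alpha> (ivl_above p) \<le> RL_above \<alpha> (of_rat p)"
      unfolding eq by (rule Sup_least) (auto intro: RL_above_upper simp: of_rat_less)
    show "RL_above \<alpha> (of_rat p) \<le> \<alpha> (ivl_above p)"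
      unfolding RL_above_def
    proof (rule Sup_least, clarify)
      fix r s assume "(of_rat p :: real) < of_rat r"
      then have "p < r" by (simp add: of_rat_less)
      show "\<alpha> (ivl r s) \<le> \<alpha> (ivl_above p)"
      proof (cases "s \<le> r")
        case True then show ?thesis by (simp add: RL_respects(5))
      next
        case False
        then show ?thesis unfolding eq using \<open>p < r\<close> by (intro Sup_upper) force
      qed
    qed
  qed
qed

lemma RL_ivl_below: "\<alpha> (ivl_below q) = RL_below \<alpha> (of_rat q)"
proof -
  have eq: "\<alpha> (ivl_below q) = \<Squnion> {\<alpha> (ivl r s) | r s. r < q \<and> s < q}"
    unfolding ivl_below_def frame_homD(3)[OF RL_frame_hom]
    by (rule arg_cong[of _ _ Sup]) blast
  show ?thesis
  proof (rule order.antisym)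
    show "\<alpha> (ivl_below q) \<le> RL_below \<alpha> (of_rat q)"
      unfolding eq by (rule Sup_least) (auto intro: RL_below_upper simp: of_rat_less)
    show "RL_below \<alpha> (of_rat q) \<le> \<alpha> (ivl_below q)"
      unfolding RL_below_def
    proof (rule Sup_least, clarify)
      fix r s assume "of_rat s < (of_rat q :: real)"
      then have "s < q" by (simp add: of_rat_less)
      show "\<alpha> (ivl r s) \<le> \<alpha> (ivl_below q)"
      proof (cases "s \<le> r")
        case True then show ?thesis by (simp add: RL_respects(5))
      next
        case False
        then show ?thesis unfolding eq using \<open>s < q\<close> by (intro Sup_upper) force
      qed
    qed
  qed
qed

lemma coz_eq_RL_cuts: "coz \<alpha> = RL_below \<alpha> 0 \<squnion> RL_above \<alpha> 0"
  by (simp add: coz_def RL_ivl_above RL_ivl_below)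

text \<open>By (R1), an interval ending before \<open>r\<close> and one starting after
  \<open>r\<close> meet in an interval with endpoints out of order. Disjointness thus holds at every
  real \<open>r\<close>; only covering \<top> can fail.\<close>

lemma RL_below_inf_above: "RL_below \<alpha> r \<sqinter> RL_above \<alpha> r = \<bottom>"
proof -
  have "RL_below \<alpha> r \<sqinter> RL_above \<alpha> r \<le> \<bottom>"
    unfolding RL_below_def RL_above_def
  proof (rule inf_frame_le_Sup2, clarify)
    fix p q p' q' assume "of_rat q < r" "r < of_rat p'"
    then have "(of_rat q :: real) < of_rat p'" by linarith
    then have "q < p'" by (simp add: of_rat_less)
    then have "min q q' \<le> max p p'" by (simp add: min_le_iff_disj le_max_iff_disj)
    then have "\<alpha> (ivl p q) \<sqinter> \<alpha> (ivl p' q') = \<bottom>"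
      unfolding RL_respects(1) by (rule RL_respects(5))
    then show "\<alpha> (ivl p q) \<sqinter> \<alpha> (ivl p' q') \<le> \<bottom>" by simp
  qed
  then show ?thesis by (simp add: bot_unique)
qed

section \<open>Translation by a real constant\<close>

lemma RL_minus_const_ivl:
  "RL_minus \<alpha> (RL_const r) (ivl p q) = \<Squnion> {\<alpha> (ivl a b) | a b. \<exists>u v. of_rat u < - r \<and> - r < of_rat v \<and>
     {x + y | x y. x \<in> ropen a b \<and> y \<in> ropen u v} \<subseteq> ropen p q}"
    (is "?l = \<Squnion> ?S")
proof -
  \<comment> \<open>The negated constant on \<open>(u, v)\<close> is the constant on
    \<open>(- v, - u)\<close>, worth \<top> or \<bottom>. Hence each meet is a value of \<alpha> or
    contributes nothing, and a join over \<alpha> alone remains.\<close>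
  have l: "?l = \<Squnion> {\<alpha> (ivl a b) \<sqinter> (if of_rat (- v) < r \<and> r < of_rat (- u) then \<top> else \<bottom>) | a b u v.
      {x + y | x y. x \<in> ropen a b \<and> y \<in> ropen u v} \<subseteq> ropen p q}" (is "_ = \<Squnion> ?T")
    unfolding RL_minus_def RL_op(2)[OF \<alpha> RL_uminus(1)[OF RL_const(1)] continuous_on_plus]
      RL_uminus(2)[OF RL_const(1)] RL_const(2) ..
  have iff: "of_rat (- v) < r \<and> r < of_rat (- u) \<longleftrightarrow> of_rat u < - r \<and> - r < of_rat v" for u v
    by (auto simp: of_rat_minus)
  show ?thesis
    unfolding l iff
  proof (rule order.antisym)
    show "\<Squnion> {\<alpha> (ivl a b) \<sqinter> (if of_rat u < - r \<and> - r < of_rat v then \<top> else \<bottom>) | a b u v.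
      {x + y | x y. x \<in> ropen a b \<and> y \<in> ropen u v} \<subseteq> ropen p q} \<le> \<Squnion> ?S"
    proof (rule Sup_least, clarify)
      fix a b u v
      assume sub: "{x + y | x y. x \<in> ropen a b \<and> y \<in> ropen u v} \<subseteq> ropen p q"
      show "\<alpha> (ivl a b) \<sqinter> (if of_rat u < - r \<and> - r < of_rat v then \<top> else \<bottom>) \<le> \<Squnion> ?S"
      proof (cases "of_rat u < - r \<and> - r < of_rat v")
        case True
        then have "\<alpha> (ivl a b) \<le> \<Squnion> ?S" using sub by (intro Sup_upper) blast
        then show ?thesis using True by simp
      next
        case False
        then show ?thesis by (simp only: if_False inf_bot_right bot_least)
      qed
    qed
    show "\<Squnion> ?S \<le> \<Squnion> {\<alpha> (ivl a b) \<sqinter> (if of_rat u < - r \<and> - r < of_rat v then \<top> else \<bottom>) | a b u v.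
      {x + y | x y. x \<in> ropen a b \<and> y \<in> ropen u v} \<subseteq> ropen p q}"
    proof (rule Sup_subset_mono, clarify)
      fix a b u v
      assume "of_rat u < - r" "- r < of_rat v"
        "{x + y | x y. x \<in> ropen a b \<and> y \<in> ropen u v} \<subseteq> ropen p q"
      then show "\<exists>a' b' u v. \<alpha> (ivl a b) = \<alpha> (ivl a' b') \<sqinter>
          (if of_rat u < - r \<and> - r < of_rat v then \<top> else \<bottom>) \<and>
          {x + y | x y. x \<in> ropen a' b' \<and> y \<in> ropen u v} \<subseteq> ropen p q"
        by (intro exI[of _ a] exI[of _ b] exI[of _ u] exI[of _ v]) simp
    qed
  qed
qed

text \<open>The endpoints \<open>p + r\<close> and \<open>q + r\<close> may be irrational, so no
  single generator describes the translate; an arbitrary upper bound \<open>c\<close> is tested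
  instead. The bounds on \<open>a\<close> and \<open>b\<close> are non-strict because they come from
  the interior points of an open interval by density.\<close>

lemma RL_minus_const_le:
  assumes "\<And>a b. a < b \<Longrightarrow> of_rat p + r \<le> of_rat a \<Longrightarrow> of_rat b \<le> of_rat q + r \<Longrightarrow> \<alpha> (ivl a b) \<le> c"
  shows "RL_minus \<alpha> (RL_const r) (ivl p q) \<le> c"
  unfolding RL_minus_const_ivl
proof (rule Sup_least, clarify)
  fix a b u v
  assume uv: "of_rat u < - r" "- r < of_rat v"
    and sub: "{x + y | x y. x \<in> ropen a b \<and> y \<in> ropen u v} \<subseteq> ropen p q"
  show "\<alpha> (ivl a b) \<le> c"
  \<comment> \<open>For \<open>b \<le> a\<close> the interval is empty and \<open>sub\<close> says
    nothing, but then \<alpha> has the value \<bottom>.\<close>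
  proof (cases "a < b")
    case True
    have *: "of_rat p + r < x \<and> x < of_rat q + r" if "of_rat a < x" "x < of_rat b" for x
    proof -
      have "x \<in> ropen a b" "- r \<in> ropen u v" using uv that by (simp_all add: ropen_def)
      then have "x + - r \<in> ropen p q" using sub by blast
      then show ?thesis by (auto simp: ropen_def)
    qed
    have ab: "(of_rat a :: real) < of_rat b" using True by (simp add: of_rat_less)
    have "of_rat p + r \<le> of_rat a"
      by (rule dense_ge_bounded[OF ab]) (use * in force)
    moreover have "of_rat b \<le> of_rat q + r"
      by (rule dense_le_bounded[OF ab]) (use * in force)
    ultimately show ?thesis by (rule assms[OF True])
  qed (simp add: RL_respects(5))
qed

text \<open>The shift by \<open>- r\<close> is replaced by rational shifts \<open>u\<close> and
  \<open>v\<close> on either side of it, which later proofs choose as close to \<open>- r\<close> as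
  they need.\<close>

lemma RL_minus_const_ge:
  assumes "of_rat u < - r" "- r < of_rat v"
  shows "\<alpha> (ivl a b) \<le> RL_minus \<alpha> (RL_const r) (ivl (a + u) (b + v))"
proof -
  have "{x + y | x y. x \<in> ropen a b \<and> y \<in> ropen u v} \<subseteq> ropen (a + u) (b + v)"
    by (auto simp: ropen_def of_rat_add)
  then show ?thesis
    unfolding RL_minus_const_ivl using assms by (intro Sup_upper) blast
qed

lemma RL_above_minus_const: "RL_above (RL_minus \<alpha> (RL_const r)) 0 = RL_above \<alpha> r"
proof (rule order.antisym)
  show "RL_above (RL_minus \<alpha> (RL_const r)) 0 \<le> RL_above \<alpha> r"
    unfolding RL_above_def[of "RL_minus _ _"]
  proof (rule Sup_least, clarify)
    fix p q assume pq: "0 < (of_rat p :: real)"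
    show "RL_minus \<alpha> (RL_const r) (ivl p q) \<le> RL_above \<alpha> r"
      \<comment> \<open>The strict \<open>0 < p\<close> makes up for the non-strict bound
        \<open>p + r \<le> a\<close>. The deleted simp rules would move \<open>pq\<close> from the
        reals to the rationals, away from the goal.\<close>
      by (rule RL_minus_const_le) (use pq in \<open>auto intro!: RL_above_upper simp del: zero_less_of_rat_iff of_rat_less_0_iff\<close>)
  qed
  show "RL_above \<alpha> r \<le> RL_above (RL_minus \<alpha> (RL_const r)) 0"
    unfolding RL_above_def[of \<alpha>]
  proof (rule Sup_least, clarify)
    fix p q assume p: "r < of_rat p"
    \<comment> \<open>With \<open>u\<close> between \<open>- p\<close> and \<open>- r\<close>, the
      shifted left endpoint \<open>p + u\<close> stays positive. The right endpoint is free, so any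
      \<open>v\<close> above \<open>- r\<close> will do.\<close>
    obtain u where u: "- of_rat p < (of_rat u :: real)" "of_rat u < - r"
      using of_rat_dense[of "- of_rat p" "- r"] p by auto
    obtain v where v: "- r < of_rat v" using of_rat_dense[of "- r" "- r + 1"] by auto
    have "0 < (of_rat (p + u) :: real)" using u by (simp add: of_rat_add)
    then show "\<alpha> (ivl p q) \<le> RL_above (RL_minus \<alpha> (RL_const r)) 0"
      by (rule order_trans[OF RL_minus_const_ge[OF u(2) v] RL_above_upper[where \<alpha> = "RL_minus \<alpha> (RL_const r)"]])
  qed
qed

lemma RL_below_minus_const: "RL_below (RL_minus \<alpha> (RL_const r)) 0 = RL_below \<alpha> r"
proof (rule order.antisym)
  show "RL_below (RL_minus \<alpha> (RL_const r)) 0 \<le> RL_below \<alpha> r"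
    unfolding RL_below_def[of "RL_minus _ _"]
  proof (rule Sup_least, clarify)
    fix p q assume pq: "of_rat q < (0 :: real)"
    show "RL_minus \<alpha> (RL_const r) (ivl p q) \<le> RL_below \<alpha> r"
      by (rule RL_minus_const_le) (use pq in \<open>auto intro!: RL_below_upper simp del: zero_less_of_rat_iff of_rat_less_0_iff\<close>)
  qed
  show "RL_below \<alpha> r \<le> RL_below (RL_minus \<alpha> (RL_const r)) 0"
    unfolding RL_below_def[of \<alpha>]
  proof (rule Sup_least, clarify)
    fix p q assume q: "of_rat q < r"
    obtain v where v: "- r < of_rat v" "of_rat v < (- of_rat q :: real)"
      using of_rat_dense[of "- r" "- of_rat q"] q by auto
    obtain u where u: "of_rat u < - r" using of_rat_dense[of "- r - 1" "- r"] by auto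
    have "(of_rat (q + v) :: real) < 0" using v by (simp add: of_rat_add)
    then show "\<alpha> (ivl p q) \<le> RL_below (RL_minus \<alpha> (RL_const r)) 0"
      by (rule order_trans[OF RL_minus_const_ge[OF u v(1)] RL_below_upper[where \<alpha> = "RL_minus \<alpha> (RL_const r)"]])
  qed
qed

end

text \<open>This turns membership in \<open>R_set\<close> into a condition on \<alpha> itself:
  \<open>r\<close> is outside exactly when the cuts at \<open>r\<close> join to \<top>.\<close>

lemma coz_minus_const:
  assumes "\<alpha> \<in> RL"
  shows "coz (RL_minus \<alpha> (RL_const r)) = RL_below \<alpha> r \<squnion> RL_above \<alpha> r"
  using coz_eq_RL_cuts[OF RL_minus[OF assms RL_const(1)]]
  by (simp add: RL_below_minus_const[OF assms] RL_above_minus_const[OF assms])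

section \<open>Cozero elements as joins of complemented cuts\<close>

lemma complemented_RL_cuts:
  assumes "\<alpha> \<in> RL" "r \<notin> R_set \<alpha>"
  shows "complemented (RL_below \<alpha> r)" "complemented (RL_above \<alpha> r)"
proof -
  have sup: "RL_below \<alpha> r \<squnion> RL_above \<alpha> r = \<top>"
    using assms by (simp add: R_set_def coz_minus_const)
  note inf = RL_below_inf_above[OF assms(1), of r]
  show "complemented (RL_below \<alpha> r)"
    unfolding complemented_def using inf sup by blast
  show "complemented (RL_above \<alpha> r)"
    unfolding complemented_def
    using inf[unfolded inf_commute[of "RL_below _ _"]] sup[unfolded sup_commute[of "RL_below _ _"]]
    by blast
qed

text \<open>A nonempty open interval is uncountable. This is the only use of countability in this
  direction of the theorem.\<close>

lemma C_c_value_avoiding_range: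
  assumes "\<alpha> \<in> C_c" "(x::real) < y"
  obtains r where "x < r" "r < y" "r \<notin> R_set \<alpha>"
proof -
  have "countable (R_set \<alpha>)" using assms(1) by (simp add: C_c_def)
  moreover have "uncountable {x<..<y}" using assms(2) by (simp add: uncountable_open_interval)
  ultimately have "\<not> {x<..<y} \<subseteq> R_set \<alpha>" using countable_subset by blast
  then obtain r where "r \<in> {x<..<y}" "r \<notin> R_set \<alpha>" by blast
  then show thesis using that[of r] by simp
qed

lemma coz_le_Sup_complemented:
  fixes \<alpha> :: "reals_frame \<Rightarrow> 'a::frame"
  assumes c: "\<alpha> \<in> C_c"
  shows "coz \<alpha> \<le> \<Squnion> {c. complemented c \<and> c \<le> coz \<alpha>}" (is "_ \<le> ?S")
proof -
  have \<alpha>: "\<alpha> \<in> RL" using c by (simp add: C_c_def)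
  have "RL_above \<alpha> 0 \<le> ?S"
    unfolding RL_above_def
  proof (rule Sup_least, clarify)
    fix p q assume "0 < (of_rat p :: real)"
    \<comment> \<open>Taking \<open>r\<close> below \<open>p\<close> puts the generator under the
      cut at \<open>r\<close>; taking it above \<open>0\<close> keeps that cut under
      \<open>coz \<alpha>\<close>.\<close>
    then obtain r where r: "0 < r" "r < of_rat p" "r \<notin> R_set \<alpha>"
      using C_c_value_avoiding_range[OF c] by blast
    have "RL_above \<alpha> r \<le> coz \<alpha>"
      unfolding coz_eq_RL_cuts[OF \<alpha>] using r(1) by (intro le_supI2 RL_above_antimono) simp
    then have "RL_above \<alpha> r \<le> ?S"
      using complemented_RL_cuts(2)[OF \<alpha> r(3)] by (intro Sup_upper) blast
    then show "\<alpha> (ivl p q) \<le> ?S" by (rule order_trans[OF RL_above_upper[OF r(2)]])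
  qed
  moreover have "RL_below \<alpha> 0 \<le> ?S"
    unfolding RL_below_def
  proof (rule Sup_least, clarify)
    fix p q assume "of_rat q < (0 :: real)"
    then obtain r where r: "of_rat q < r" "r < 0" "r \<notin> R_set \<alpha>"
      using C_c_value_avoiding_range[OF c] by blast
    have "RL_below \<alpha> r \<le> coz \<alpha>"
      unfolding coz_eq_RL_cuts[OF \<alpha>] using r(2) by (intro le_supI1 RL_below_mono) simp
    then have "RL_below \<alpha> r \<le> ?S"
      using complemented_RL_cuts(1)[OF \<alpha> r(3)] by (intro Sup_upper) blast
    then show "\<alpha> (ivl p q) \<le> ?S" by (rule order_trans[OF RL_below_upper[OF r(1)]])
  qed
  ultimately show ?thesis by (subst coz_eq_RL_cuts[OF \<alpha>]) (rule le_supI)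
qed

section \<open>Complemented elements as cozero elements of two-valued functions\<close>

lemma RL_above_const: "RL_above (RL_const s) r = (if r < s then \<top> else \<bottom> :: 'a::frame)"
proof (cases "r < s")
  case True
  then obtain p where p: "r < of_rat p" "of_rat p < s" using of_rat_dense by blast
  obtain q where q: "s < of_rat q" using of_rat_dense[of s "s + 1"] by auto
  have "RL_const s (ivl p q) = (\<top> :: 'a)" using p q by (simp add: RL_const(2))
  then have "(\<top> :: 'a) \<le> RL_above (RL_const s) r" using RL_above_upper[OF p(1)] by metis
  then show ?thesis using True by (simp add: top_unique)
next
  case False
  have "RL_above (RL_const s) r \<le> (\<bottom> :: 'a)"
    unfolding RL_above_def by (rule Sup_least) (use False in \<open>auto simp: RL_const(2)\<close>)
  then show ?thesis using False by (simp add: bot_unique)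
qed

lemma RL_below_const: "RL_below (RL_const s) r = (if s < r then \<top> else \<bottom> :: 'a::frame)"
proof (cases "s < r")
  case True
  then obtain q where q: "s < of_rat q" "of_rat q < r" using of_rat_dense by blast
  obtain p where p: "of_rat p < s" using of_rat_dense[of "s - 1" s] by auto
  have "RL_const s (ivl p q) = (\<top> :: 'a)" using p q by (simp add: RL_const(2))
  then have "(\<top> :: 'a) \<le> RL_below (RL_const s) r" using RL_below_upper[OF q(2)] by metis
  then show ?thesis using True by (simp add: top_unique)
next
  case False
  have "RL_below (RL_const s) r \<le> (\<bottom> :: 'a)"
    unfolding RL_below_def by (rule Sup_least) (use False in \<open>auto simp: RL_const(2)\<close>)
  then show ?thesis using False by (simp add: bot_unique)
qed

text \<open>Meets with a fixed element and binary joins both commute with arbitrary joins, so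
  \<beta> and \<gamma> may be any functions. Indexing the join by pairs in \<open>img\<close> keeps
  the two summands under a common index.\<close>

lemma RL_above_glue:
  "RL_above (\<lambda>x. (a \<sqinter> \<beta> x) \<squnion> (b \<sqinter> \<gamma> x)) r = (a \<sqinter> RL_above \<beta> r) \<squnion> (b \<sqinter> RL_above \<gamma> r)"
proof -
  have img: "RL_above \<delta> r = (\<Squnion>(p, q)\<in>{(p, q). r < of_rat p}. \<delta> (ivl p q))"
    for \<delta> :: "reals_frame \<Rightarrow> 'a"
    unfolding RL_above_def by (rule arg_cong[of _ _ Sup]) auto
  show ?thesis
    unfolding img by (simp add: inf_Sup_frame image_image complete_lattice_class.SUP_sup_distrib case_prod_unfold)
qed

lemma RL_below_glue:
  "RL_below (\<lambda>x. (a \<sqinter> \<beta> x) \<squnion> (b \<sqinter> \<gamma> x)) r = (a \<sqinter> RL_below \<beta> r) \<squnion> (b \<sqinter> RL_below \<gamma> r)"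
proof -
  have img: "RL_below \<delta> r = (\<Squnion>(p, q)\<in>{(p, q). of_rat q < r}. \<delta> (ivl p q))"
    for \<delta> :: "reals_frame \<Rightarrow> 'a"
    unfolding RL_below_def by (rule arg_cong[of _ _ Sup]) auto
  show ?thesis
    unfolding img by (simp add: inf_Sup_frame image_image complete_lattice_class.SUP_sup_distrib case_prod_unfold)
qed

lemma complemented_in_Coz_c:
  fixes a :: "'a::frame"
  assumes "complemented a"
  shows "a \<in> Coz_c"
proof -
  obtain b where ab: "a \<sqinter> b = \<bottom>" "a \<squnion> b = \<top>" using assms unfolding complemented_def by blast
  define \<alpha> where "\<alpha> = (\<lambda>x. (a \<sqinter> RL_const 1 x) \<squnion> (b \<sqinter> RL_const 0 x))"
  have \<alpha>: "\<alpha> \<in> RL"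
    unfolding RL_def mem_Collect_eq \<alpha>_def
    by (rule frame_hom_glue[OF ab]) (use RL_const(1) in \<open>auto simp: RL_def\<close>)
  have cuts: "RL_above \<alpha> r = (if r < 1 then a else \<bottom>) \<squnion> (if r < 0 then b else \<bottom>)"
    "RL_below \<alpha> r = (if 1 < r then a else \<bottom>) \<squnion> (if 0 < r then b else \<bottom>)" for r
    unfolding \<alpha>_def RL_above_glue RL_below_glue RL_above_const RL_below_const by simp_all
  have "R_set \<alpha> \<subseteq> {0, 1}"
  proof
    fix r assume r: "r \<in> R_set \<alpha>"
    show "r \<in> {0, 1}"
    proof (rule ccontr)
      assume "r \<notin> {0, 1}"
      \<comment> \<open>For \<open>0 < r < 1\<close> the cuts are \<open>b\<close> and
        \<open>a\<close>; outside \<open>[0, 1]\<close> one cut is \<open>a \<squnion> b\<close> and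
        the other is \<bottom>.\<close>
      then have "r < 0 \<or> 0 < r \<and> r < 1 \<or> 1 < r" by auto
      then have "RL_below \<alpha> r \<squnion> RL_above \<alpha> r = \<top>"
        using ab(2) by (auto simp: cuts sup_commute)
      then show False using r by (simp add: R_set_def coz_minus_const[OF \<alpha>])
    qed
  qed
  then have "\<alpha> \<in> C_c" using \<alpha> by (simp add: C_c_def countable_subset)
  \<comment> \<open>The cuts are strict, so the value \<open>0\<close> taken on \<open>b\<close>
    lies in neither cut at \<open>0\<close>, and only \<open>a\<close> survives.\<close>
  moreover have "coz \<alpha> = a" by (simp add: coz_eq_RL_cuts[OF \<alpha>] cuts)
  ultimately show ?thesis unfolding Coz_c_def by blast
qed

theorem proposition5p5:
  fixes L :: "'a::frame itself"
  shows "zero_dimensional L \<longleftrightarrow> c_completely_regular L"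
proof
  assume "zero_dimensional L"
  then show "c_completely_regular L"
    unfolding zero_dimensional_def c_completely_regular_def
    by (rule is_base_superset) (auto intro: complemented_in_Coz_c)
next
  assume "c_completely_regular L"
  then show "zero_dimensional L"
    unfolding zero_dimensional_def c_completely_regular_def
    by (rule is_base_refine) (auto simp: Coz_c_def intro: coz_le_Sup_complemented)
qed

end
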